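(* Let $a,k,x$ be non-negative integers and let $j$ be an integer with $\max(1,k)\le j\le a+k+1$. Let $R'_{a,k,j,x}$ be the weighted region defined in the context. Then its matching generating function is \begin{multline*} M(R'_{a,k,j,x})=\left[\prod_{n=1}^a\left(\frac{2x+2k+2n-1}{2k+2n-1}\right)^{f_{a}(n)}\right]\left[\prod_{n=1}^{a-1}\left(\frac{x+k+n}{k+n}\right)^{f_{a-1}(n)}\right]\\ \times\left[\prod_{n=1}^{j-k-1}\left(\frac{2k+2n-1}{2x+2k+2n-1}\right)^{f_{j-k-1}(n)}\right]\left[\prod_{n=1}^{j-k-2}\left(\frac{k+n}{x+k+n}\right)^{f_{j-k-2}(n)}\right]\\ \times\left[\prod_{1\leq n\leq m\leq j-1}\frac{2x+n+m-1}{n+m-1}\right]\left[\prod_{n=1}^{a-j+k+1}\frac{k+j+n-1}{j+n-1}\right]\\ \times\frac{1}{2^{a+k}}\prod_{n=1}^{a-j+k+1}\left[\prod_{m=1}^{j-k}\frac{k+n+m-1}{n+m-1}\prod_{m=j-k+1}^{j-k-1+n}\frac{2k+n+m-1}{n+m-1}\right], \end{multline*} where $f_a(i)=\frac{a+1}{2}-\left|\frac{a+1}{2}-i\right|$ and empty products equal $1$.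
   Context: Work in the triangular lattice: the tiling of the plane by unit equilateral triangles whose edges lie on horizontal lines and on lines at $60^\circ$ and $120^\circ$ to the horizontal. A region is a finite union of unit triangles; a lozenge is the union of two unit triangles sharing an edge; a lozenge tiling is a covering of the region by non-overlapping lozenges. Each lozenge may carry a positive weight; the weight of a tiling is the product of the weights of its lozenges, and $M(R)$, the matching generating function, is the sum of the weights of all tilings of $R$. The region $R_{a,k,j,x}$: its boundary, traced clockwise from its northwest corner, consists of a horizontal north edge of length $x$ going east, a northeast edge of length $a+2k$ going down-right (direction $-60^\circ$), a southeast edge of length $a$ going down-left (direction $-120^\circ$), a horizontal south edge of length $x+k$ going west, and a zigzag line of $2a+2k$ unit segments going up from the west end of the south edge to the west end of the north edge, alternating northwest and northeast (starting with northwest), forming $a+k$ westward "bumps". Numbering the $a+2k$ upward-pointing unit triangles of the region with an edge on the northeast side $1,\dots,a+2k$ from the north end, the $k$ consecutive ones numbered $j,\dots,j+k-1$ are removed. The weighted region $R'_{a,k,j,x}$ is $R_{a,k,j,x}$ in which each of the $a+k$ vertical lozenges (unions of an upward and a downward unit triangle sharing a horizontal edge) occupying the bumps of the west zigzag boundary has weight $\tfrac12$; all other lozenges have weight $1$. *)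

theory Defs
  imports Complex_Main "HOL-Library.Disjoint_Sets" "HOL-Library.Product_Plus"
begin

section \<open>Unit triangles, lozenges and tilings\<close>

text \<open>
  A pair (p,q) stands for the point p * e + q * e' of the triangular lattice, where e is the
  horizontal unit vector pointing east and e' is the unit vector at 60 degrees to it; thus q is
  the height of the point (in units of sqrt 3 / 2) and p + q/2 is its horizontal coordinate.
  \<open>Up p q\<close> and \<open>Down p q\<close> are the two unit triangles into which the unit rhombus
  with southwest corner (p,q) is cut by its short diagonal.
\<close>

type_synonym point = "int \<times> int"

datatype triangle = Up int int | Down int int

fun vertices :: "triangle \<Rightarrow> point set" where
  "vertices (Up p q) = {(p, q), (p + 1, q), (p, q + 1)}"
| "vertices (Down p q) = {(p + 1, q), (p, q + 1), (p + 1, q + 1)}"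

definition edges :: "triangle \<Rightarrow> point set set" where
  "edges t = {e. e \<subseteq> vertices t \<and> card e = 2}"

text \<open>A region is a set of unit triangles, and a lozenge is the set of its two unit triangles.\<close>

definition lozenge :: "triangle set \<Rightarrow> bool" where
  "lozenge L \<longleftrightarrow> (\<exists>s t. s \<noteq> t \<and> edges s \<inter> edges t \<noteq> {} \<and> L = {s, t})"

definition tilings :: "triangle set \<Rightarrow> triangle set set set" where
  "tilings R = {T. partition_on R T \<and> (\<forall>L\<in>T. lozenge L)}"

definition matching_gf :: "(triangle set \<Rightarrow> real) \<Rightarrow> triangle set \<Rightarrow> real" where
  "matching_gf w R = (\<Sum>T\<in>tilings R. \<Prod>L\<in>T. w L)"

section \<open>The weighted region\<close>

text \<open>
  The origin is the west end of the south edge, so the north edge has height 2 a + 2 k and its west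
  end is (-(a + k), 2 a + 2 k). The four inequalities other than
  the lower bound on the height say that a point is not above the line of the north side, not
  beyond the line of the northeast side, not beyond the line of the southeast side, and not more
  than 1/2 west of the vertical line through the origin. A lattice point at even height has integral
  horizontal coordinate, so the last condition cuts out exactly the zigzag. The lemma
  \<open>boundary_full_region\<close> below compares this with the clockwise description of the boundary.
\<close>

definition region_points :: "nat \<Rightarrow> nat \<Rightarrow> nat \<Rightarrow> point set" where
  "region_points a k x =
     {(p, q). 0 \<le> q \<and> q \<le> 2 * int a + 2 * int k
        \<and> p + q \<le> int x + int a + int k \<and> p \<le> int x + int k \<and> 2 * p + q \<ge> -1}"

definition full_region :: "nat \<Rightarrow> nat \<Rightarrow> nat \<Rightarrow> triangle set" where
  "full_region a k x = {t. vertices t \<subseteq> region_points a k x}"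

text \<open>
  The i-th unit triangle along the northeast side, counted from the north end; see the lemma
  \<open>ne_triangles\<close> below.
\<close>

definition ne_triangle :: "nat \<Rightarrow> nat \<Rightarrow> nat \<Rightarrow> int \<Rightarrow> triangle" where
  "ne_triangle a k x i = Up (int x - int a - int k - 1 + i) (2 * int a + 2 * int k - i)"

definition region :: "nat \<Rightarrow> nat \<Rightarrow> int \<Rightarrow> nat \<Rightarrow> triangle set" where
  "region a k j x = full_region a k x - ne_triangle a k x ` {j..j + int k - 1}"

text \<open>The shared edge of a vertical lozenge joins (p,q) to (p + 1,q).\<close>

definition vertical_lozenge :: "int \<Rightarrow> int \<Rightarrow> triangle set" where
  "vertical_lozenge p q = {Down p (q - 1), Up p q}"

text \<open>
  The tip of the i-th bump from the south (starting with i = 0) is the point (-(i + 1), 2 i + 1), at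
  horizontal coordinate -1/2.
\<close>

definition bump_lozenges :: "nat \<Rightarrow> nat \<Rightarrow> triangle set set" where
  "bump_lozenges a k = (\<lambda>i. vertical_lozenge (- (int i + 1)) (2 * int i + 1)) ` {..<a + k}"

definition bump_weight :: "nat \<Rightarrow> nat \<Rightarrow> triangle set \<Rightarrow> real" where
  "bump_weight a k L = (if L \<in> bump_lozenges a k then 1 / 2 else 1)"

definition M_region :: "nat \<Rightarrow> nat \<Rightarrow> int \<Rightarrow> nat \<Rightarrow> real" where
  "M_region a k j x = matching_gf (bump_weight a k) (region a k j x)"

definition f_exponent :: "int \<Rightarrow> int \<Rightarrow> real" where
  "f_exponent a i = (real_of_int a + 1) / 2 - \<bar>(real_of_int a + 1) / 2 - real_of_int i\<bar>"

section \<open>Comparison with the clockwise description of the boundary\<close>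

fun walk :: "point \<Rightarrow> point list \<Rightarrow> point set list" where
  "walk P [] = []"
| "walk P (d # ds) = {P, P + d} # walk (P + d) ds"

text \<open>
  The unit steps: (1,0) east, (1,-1) at -60 degrees, (0,-1) at -120 degrees, (-1,0) west,
  (-1,1) northwest, (0,1) northeast.
\<close>

definition boundary_steps :: "nat \<Rightarrow> nat \<Rightarrow> nat \<Rightarrow> point list" where
  "boundary_steps a k x =
     replicate x (1, 0) @ replicate (a + 2 * k) (1, -1) @ replicate a (0, -1)
     @ replicate (x + k) (-1, 0) @ concat (replicate (a + k) [(-1, 1), (0, 1)])"

lemma sum_list_replicate_pair: "sum_list (replicate n (c, d)) = (int n * c, int n * d)"
  by (induction n) (auto simp: zero_prod_def algebra_simps)

lemma boundary_steps_closed: "sum_list (boundary_steps a k x) = 0"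
proof -
  have z: "sum_list (concat (replicate n [(-1, 1), (0, 1)])) = (- int n, 2 * int n)" for n
    by (induction n) (auto simp: zero_prod_def)
  show ?thesis
    by (simp add: boundary_steps_def sum_list_replicate_pair z zero_prod_def)
qed

lemma Up_in_full_region:
  "Up p q \<in> full_region a k x \<longleftrightarrow> 0 \<le> q \<and> q + 1 \<le> 2 * int a + 2 * int k
     \<and> p + q + 1 \<le> int x + int a + int k \<and> p + 1 \<le> int x + int k \<and> 2 * p + q \<ge> -1"
  by (auto simp: full_region_def region_points_def)

lemma Down_in_full_region:
  "Down p q \<in> full_region a k x \<longleftrightarrow> 0 \<le> q \<and> q + 1 \<le> 2 * int a + 2 * int k
     \<and> p + q + 2 \<le> int x + int a + int k \<and> p + 1 \<le> int x + int k \<and> 2 * p + q + 2 \<ge> 0"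
  by (auto simp: full_region_def region_points_def)

lemma two_subsets:
  assumes "A \<noteq> B" "A \<noteq> C" "B \<noteq> C"
  shows "{e. e \<subseteq> {A, B, C} \<and> card e = 2} = {{A, B}, {A, C}, {B, C}}" (is "?l = ?r")
proof
  have "\<forall>e\<in>Pow {A, B, C}. card e = 2 \<longrightarrow> e \<in> ?r"
    using assms by (simp add: Pow_insert)
  then show "?l \<subseteq> ?r" by blast
  show "?r \<subseteq> ?l" using assms by simp
qed

lemma edges_Up: "edges (Up p q) =
    {{(p, q), (p + 1, q)}, {(p, q), (p, q + 1)}, {(p + 1, q), (p, q + 1)}}"
  by (simp add: edges_def two_subsets)

lemma edges_Down: "edges (Down p q) =
    {{(p + 1, q), (p, q + 1)}, {(p + 1, q), (p + 1, q + 1)}, {(p, q + 1), (p + 1, q + 1)}}"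
  by (simp add: edges_def two_subsets)

lemma bump_lozenges:
  assumes "L \<in> bump_lozenges a k"
  shows "lozenge L" and "L \<subseteq> full_region a k x"
proof -
  obtain i where i: "i < a + k" "L = vertical_lozenge (- (int i + 1)) (2 * int i + 1)"
    using assms by (auto simp: bump_lozenges_def)
  have "edges (Down (- (int i + 1)) (2 * int i)) \<inter> edges (Up (- (int i + 1)) (2 * int i + 1)) \<noteq> {}"
    by (simp add: edges_Up edges_Down)
  then show "lozenge L"
    unfolding lozenge_def i vertical_lozenge_def
    by (intro exI[of _ "Down (- (int i + 1)) (2 * int i)"]
        exI[of _ "Up (- (int i + 1)) (2 * int i + 1)"]) simp
  show "L \<subseteq> full_region a k x"
    using i by (auto simp: vertical_lozenge_def Up_in_full_region Down_in_full_region)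
qed

lemma walk_append: "walk P (ds @ ds') = walk P ds @ walk (P + sum_list ds) ds'"
  by (induction ds arbitrary: P) (auto simp: add.assoc)

lemma set_walk_replicate:
  "set (walk (u, v) (replicate n (c, d))) =
     {{(u + i * c, v + i * d), (u + (i + 1) * c, v + (i + 1) * d)} |i. 0 \<le> i \<and> i < int n}"
proof (induction n arbitrary: u v)
  case (Suc n)
  show ?case (is "?l = ?r")
  proof -
    let ?g = "\<lambda>i. {(u + i * c, v + i * d), (u + (i + 1) * c, v + (i + 1) * d)}"
    have "?l = insert (?g 0) {?g (i + 1) |i. 0 \<le> i \<and> i < int n}"
      using Suc.IH[of "u + c" "v + d"] by (simp add: algebra_simps)
    also have "\<dots> = {?g i |i. 0 \<le> i \<and> i < int (Suc n)}"
    proof (intro equalityI subsetI)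
      fix e assume "e \<in> {?g i |i. 0 \<le> i \<and> i < int (Suc n)}"
      then obtain i where i: "e = ?g i" "0 \<le> i" "i < int (Suc n)" by blast
      show "e \<in> insert (?g 0) {?g (i + 1) |i. 0 \<le> i \<and> i < int n}"
      proof (cases "i = 0")
        case False
        then have "e = ?g ((i - 1) + 1)" "0 \<le> i - 1" "i - 1 < int n" using i by auto
        then show ?thesis by blast
      qed (use i in blast)
    next
      fix e assume "e \<in> insert (?g 0) {?g (i + 1) |i. 0 \<le> i \<and> i < int n}"
      then consider "e = ?g 0" | i where "e = ?g (i + 1)" "0 \<le> i" "i < int n" by blast
      then show "e \<in> {?g i |i. 0 \<le> i \<and> i < int (Suc n)}"
      proof cases
        case 1
        then show ?thesis by (intro CollectI exI[of _ 0]) simp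
      next
        case (2 i)
        then show ?thesis by (intro CollectI exI[of _ "i + 1"]) simp
      qed
    qed
    finally show ?thesis .
  qed
qed simp

lemma set_walk_zigzag:
  "set (walk (u, v) (concat (replicate n [(-1, 1), (0, 1)]))) =
     (\<Union>i\<in>{0..<int n}. {{(u - i, v + 2 * i), (u - i - 1, v + 2 * i + 1)},
                       {(u - i - 1, v + 2 * i + 1), (u - i - 1, v + 2 * i + 2)}})"
proof (induction n arbitrary: u v)
  case (Suc n)
  have s: "{0..<int (Suc n)} = insert 0 ((\<lambda>i. i + 1) ` {0..<int n})"
  proof -
    have "i \<in> (\<lambda>i. i + 1) ` {0..<int n}" if "1 \<le> i" "i < 1 + int n" for i
      using that by (intro image_eqI[of _ _ "i - 1"]) auto
    then show ?thesis by force
  qed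
  let ?g = "\<lambda>u v i. {{(u - i, v + 2 * i), (u - i - 1, v + 2 * i + 1)},
                       {(u - i - 1, v + 2 * i + 1), (u - i - 1, v + 2 * i + 2)}}"
  have "set (walk (u, v) (concat (replicate (Suc n) [(-1, 1), (0, 1)]))) =
      ?g u v 0 \<union> set (walk (u - 1, v + 2) (concat (replicate n [(-1, 1), (0, 1)])))"
    by (simp add: add.assoc)
  also have "\<dots> = ?g u v 0 \<union> (\<Union>i\<in>{0..<int n}. ?g (u - 1) (v + 2) i)"
    by (simp only: Suc.IH)
  also have "(\<Union>i\<in>{0..<int n}. ?g (u - 1) (v + 2) i) = (\<Union>i\<in>{0..<int n}. ?g u v (i + 1))"
    by (intro SUP_cong refl) (simp add: algebra_simps)
  also have "?g u v 0 \<union> \<dots> = (\<Union>i\<in>{0..<int (Suc n)}. ?g u v i)"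
    unfolding s by (simp only: UN_insert UN_extend_simps image_image)
  finally show ?case .
qed simp

text \<open>The i-th edge of the northeast side, from the north, belongs to the i-th triangle.\<close>

lemma ne_triangles:
  "ne_triangle a k x ` {1..int a + 2 * int k} =
     {t \<in> full_region a k x. (\<exists>p q. t = Up p q) \<and>
        edges t \<inter> set (walk (int x - int a - int k, 2 * int a + 2 * int k)
                            (replicate (a + 2 * k) (1, -1))) \<noteq> {}}" (is "?l = ?r")
proof (intro equalityI subsetI)
  fix t assume "t \<in> ?l"
  then obtain i where i: "t = ne_triangle a k x i" "1 \<le> i" "i \<le> int a + 2 * int k" by auto
  have "t \<in> full_region a k x"
    using i by (auto simp: ne_triangle_def Up_in_full_region)
  moreover have "\<exists>p q. t = Up p q" using i by (auto simp: ne_triangle_def)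
  moreover have "{(int x - int a - int k - 1 + i + 1, 2 * int a + 2 * int k - i),
                  (int x - int a - int k - 1 + i, 2 * int a + 2 * int k - i + 1)} \<in> edges t"
    by (simp add: i ne_triangle_def edges_Up)
  moreover have "{(int x - int a - int k - 1 + i + 1, 2 * int a + 2 * int k - i),
                  (int x - int a - int k - 1 + i, 2 * int a + 2 * int k - i + 1)}
      \<in> set (walk (int x - int a - int k, 2 * int a + 2 * int k) (replicate (a + 2 * k) (1, -1)))"
    unfolding set_walk_replicate using i
    by (intro CollectI exI[of _ "i - 1"]) (auto simp: doubleton_eq_iff)
  ultimately show "t \<in> ?r" by blast
next
  fix t assume "t \<in> ?r"
  then obtain p q e where t: "t \<in> full_region a k x" "t = Up p q" "e \<in> edges (Up p q)"
    and e: "e \<in> set (walk (int x - int a - int k, 2 * int a + 2 * int k)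
                          (replicate (a + 2 * k) (1, -1)))" by blast
  from e obtain i where i: "0 \<le> i" "i < int a + 2 * int k"
    "e = {(int x - int a - int k + i, 2 * int a + 2 * int k - i),
          (int x - int a - int k + i + 1, 2 * int a + 2 * int k - i - 1)}"
    unfolding set_walk_replicate by (auto simp: algebra_simps)
  have "t = ne_triangle a k x (i + 1)"
    using t i by (auto simp: edges_Up ne_triangle_def doubleton_eq_iff)
  then show "t \<in> ?l" using i by auto
qed

text \<open>
  The edges that belong to exactly one triangle of the region form the boundary path. (If
  a = k = 0, the region is empty and the path runs along a segment and back.)
\<close>

lemma boundary_full_region:
  assumes "a + k > 0"
  shows "{e. \<exists>!t. t \<in> full_region a k x \<and> e \<in> edges t} =
         set (walk (- int a - int k, 2 * int a + 2 * int k) (boundary_steps a k x))"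
  (is "?l = ?r")
proof -
  let ?R = "full_region a k x"
  have pos: "0 \<le> int a" "0 \<le> int k" "0 \<le> int x" "0 < int a + int k"
    using assms by auto
  have hor: "{(p, q), (p + 1, q)} \<in> edges t \<longleftrightarrow> t = Up p q \<or> t = Down p (q - 1)" for p q t
    by (cases t) (auto simp: edges_Up edges_Down doubleton_eq_iff)
  have rise: "{(p, q), (p, q + 1)} \<in> edges t \<longleftrightarrow> t = Up p q \<or> t = Down (p - 1) q" for p q t
    by (cases t) (auto simp: edges_Up edges_Down doubleton_eq_iff)
  have fall: "{(p + 1, q), (p, q + 1)} \<in> edges t \<longleftrightarrow> t = Up p q \<or> t = Down p q" for p q t
    by (cases t) (auto simp: edges_Up edges_Down doubleton_eq_iff)
  have ex1: "(\<exists>!t. t \<in> ?R \<and> (t = Up p q \<or> t = Down p' q'))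
      \<longleftrightarrow> (Up p q \<in> ?R) \<noteq> (Down p' q' \<in> ?R)" for p q p' q'
    by auto
  let ?H = "2 * int a + 2 * int k"
  have UN_pair: "(\<Union>i\<in>{0..<n}. {F i, G i}) = {F i |i. 0 \<le> i \<and> i < n} \<union> {G i |i. 0 \<le> i \<and> i < n}"
    for n :: int and F G :: "int \<Rightarrow> point set"
    by auto
  have r: "?r = {{(- int a - int k + i, ?H), (- int a - int k + i + 1, ?H)} |i. 0 \<le> i \<and> i < int x}
     \<union> {{(int x - int a - int k + i, ?H - i), (int x - int a - int k + i + 1, ?H - i - 1)} |i.
          0 \<le> i \<and> i < int a + 2 * int k}
     \<union> {{(int x + int k, int a - i), (int x + int k, int a - i - 1)} |i. 0 \<le> i \<and> i < int a}
     \<union> {{(int x + int k - i, 0), (int x + int k - i - 1, 0)} |i. 0 \<le> i \<and> i < int x + int k}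
     \<union> {{(- i, 2 * i), (- i - 1, 2 * i + 1)} |i. 0 \<le> i \<and> i < int a + int k}
     \<union> {{(- i - 1, 2 * i + 1), (- i - 1, 2 * i + 2)} |i. 0 \<le> i \<and> i < int a + int k}"
    unfolding boundary_steps_def walk_append set_append sum_list_replicate_pair add_Pair
      set_walk_replicate set_walk_zigzag UN_pair
    by (simp add: algebra_simps Un_assoc)
  have form: "(\<exists>p q. e = {(p, q), (p + 1, q)}) \<or> (\<exists>p q. e = {(p, q), (p, q + 1)})
      \<or> (\<exists>p q. e = {(p + 1, q), (p, q + 1)})" if "e \<in> ?l" for e
  proof -
    from that obtain t where "e \<in> edges t" by blast
    then show ?thesis
      by (cases t) (auto simp: edges_Up edges_Down)
  qed
  have H: "{(p, q), (p + 1, q)} \<in> ?l \<longleftrightarrow>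
      q = ?H \<and> - int a - int k \<le> p \<and> p < int x - int a - int k \<or> q = 0 \<and> 0 \<le> p \<and> p < int x + int k"
    for p q
    unfolding mem_Collect_eq hor ex1 Up_in_full_region Down_in_full_region
    using pos by (smt (z3))
  have A: "{(p, q), (p, q + 1)} \<in> ?l \<longleftrightarrow>
      p = int x + int k \<and> 0 \<le> q \<and> q < int a \<or> 2 * p + q = -1 \<and> 0 \<le> q \<and> q < ?H"
    for p q
    unfolding mem_Collect_eq rise ex1 Up_in_full_region Down_in_full_region
    using pos by (smt (z3))
  have B: "{(p + 1, q), (p, q + 1)} \<in> ?l \<longleftrightarrow>
      p + q + 1 = int x + int a + int k \<and> int a \<le> q \<and> q < ?H \<or> 2 * p + q + 2 = 0 \<and> 0 \<le> q \<and> q < ?H"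
    for p q
    unfolding mem_Collect_eq fall ex1 Up_in_full_region Down_in_full_region
    using pos by (smt (z3))
  show ?thesis
  proof (intro equalityI subsetI)
    fix e assume e: "e \<in> ?l"
    from form[OF e] consider p q where "e = {(p, q), (p + 1, q)}" | p q where "e = {(p, q), (p, q + 1)}"
      | p q where "e = {(p + 1, q), (p, q + 1)}" by blast
    then show "e \<in> ?r"
    proof cases
      case (1 p q)
      from e[unfolded 1 H] show ?thesis
      proof
        assume *: "q = ?H \<and> - int a - int k \<le> p \<and> p < int x - int a - int k"
        have "\<exists>i. e = {(- int a - int k + i, ?H), (- int a - int k + i + 1, ?H)} \<and> 0 \<le> i \<and> i < int x"
          using * by (intro exI[of _ "p + int a + int k"]) (auto simp: 1)
        then show ?thesis unfolding r by blast
      next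
        assume *: "q = 0 \<and> 0 \<le> p \<and> p < int x + int k"
        have "\<exists>i. e = {(int x + int k - i, 0), (int x + int k - i - 1, 0)} \<and> 0 \<le> i \<and> i < int x + int k"
          using * by (intro exI[of _ "int x + int k - 1 - p"]) (auto simp: 1)
        then show ?thesis unfolding r by blast
      qed
    next
      case (2 p q)
      from e[unfolded 2 A] show ?thesis
      proof
        assume *: "p = int x + int k \<and> 0 \<le> q \<and> q < int a"
        have "\<exists>i. e = {(int x + int k, int a - i), (int x + int k, int a - i - 1)} \<and> 0 \<le> i \<and> i < int a"
          using * by (intro exI[of _ "int a - 1 - q"]) (auto simp: 2)
        then show ?thesis unfolding r by blast
      next
        assume *: "2 * p + q = -1 \<and> 0 \<le> q \<and> q < ?H"
        have "\<exists>i. e = {(- i - 1, 2 * i + 1), (- i - 1, 2 * i + 2)} \<and> 0 \<le> i \<and> i < int a + int k"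
          using * by (intro exI[of _ "- p - 1"]) (auto simp: 2 doubleton_eq_iff)
        then show ?thesis unfolding r by blast
      qed
    next
      case (3 p q)
      from e[unfolded 3 B] show ?thesis
      proof
        assume *: "p + q + 1 = int x + int a + int k \<and> int a \<le> q \<and> q < ?H"
        have "\<exists>i. e = {(int x - int a - int k + i, ?H - i), (int x - int a - int k + i + 1, ?H - i - 1)}
            \<and> 0 \<le> i \<and> i < int a + 2 * int k"
          using * by (intro exI[of _ "?H - 1 - q"]) (auto simp: 3)
        then show ?thesis unfolding r by blast
      next
        assume *: "2 * p + q + 2 = 0 \<and> 0 \<le> q \<and> q < ?H"
        have "\<exists>i. e = {(- i, 2 * i), (- i - 1, 2 * i + 1)} \<and> 0 \<le> i \<and> i < int a + int k"
          using * by (intro exI[of _ "- p - 1"]) (auto simp: 3 doubleton_eq_iff)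
        then show ?thesis unfolding r by blast
      qed
    qed
  next
    fix e assume "e \<in> ?r"
    then show "e \<in> ?l"
      unfolding r
    proof (elim UnE CollectE exE conjE)
      fix i assume "e = {(- int a - int k + i, ?H), (- int a - int k + i + 1, ?H)}"
        "0 \<le> i" "i < int x"
      then show "e \<in> ?l" using H[of "- int a - int k + i" ?H] by simp
    next
      fix i assume "e = {(int x - int a - int k + i, ?H - i),
          (int x - int a - int k + i + 1, ?H - i - 1)}" "0 \<le> i" "i < int a + 2 * int k"
      then show "e \<in> ?l" using B[of "int x - int a - int k + i" "?H - i - 1"]
        by (simp add: insert_commute)
    next
      fix i assume "e = {(int x + int k, int a - i), (int x + int k, int a - i - 1)}"
        "0 \<le> i" "i < int a"
      then show "e \<in> ?l" using A[of "int x + int k" "int a - i - 1"]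
        by (simp add: insert_commute)
    next
      fix i assume "e = {(int x + int k - i, 0), (int x + int k - i - 1, 0)}"
        "0 \<le> i" "i < int x + int k"
      then show "e \<in> ?l" using H[of "int x + int k - i - 1" 0]
        by (simp add: insert_commute)
    next
      fix i assume "e = {(- i, 2 * i), (- i - 1, 2 * i + 1)}" "0 \<le> i" "i < int a + int k"
      then show "e \<in> ?l" using B[of "- i - 1" "2 * i"] by simp
    next
      fix i assume "e = {(- i - 1, 2 * i + 1), (- i - 1, 2 * i + 2)}" "0 \<le> i" "i < int a + int k"
      then show "e \<in> ?l" using A[of "- i - 1" "2 * i + 1"] by (simp add: add.assoc)
    qed
  qed
qed

end

theory Submission
  imports Defs "Jordan_Normal_Form.Determinant" "HOL-Computational_Algebra.Formal_Power_Series"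
begin

text \<open>
  Following a tiling through the edges parallel to the northeast side turns it into a family of
  r = a + k nonintersecting lattice paths from the northeast side to the zigzag, so the generating
  function is an r by r determinant. Its row i consists of the coefficients of
  (1 + 1/y)^x (y + 1/2) (y (y + 1))^i at the powers of y indexed by the triangles that are not
  removed. A triangular change of rows, by powers of y (y + 1) with exponents in 1/2 + Z, replaces
  the entries by single binomial coefficients with upper argument x + i + 1/2.
  The first form of the entries shows that the determinant, as a polynomial in x, vanishes to high
  order at the negative integers, the second one does the same at the negative half-integers, and
  the second one also bounds the degree. The bounds match, so only a constant remains; it is
  computed at x = 0, where the matrix is block triangular and the nontrivial block is of the type
  evaluated by Krattenthaler.
\<close>

section \<open>Tilings\<close>

text \<open>Row i belongs to the end on the zigzag numbered i from the north, column n to the n-th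
  triangle of the northeast side. A path between them has x + i + 1 steps, 2 i + 2 - n of them
  south; its last step is west with weight 1, or south, inside a bump, with weight 1/2. Marking
  south steps by 1/y gives (1 + 1/y)^(x + i) (1 + 1/(2 y)); multiplied by y^(2 i + 1), this is the
  row function above, with column n at the power n - 1. The weight 1/2 makes the second form
  possible: with v = y (y + 1) one has (y + 1/2)^2 = v + 1/4, so (y + 1/2) v^i is v^(i + 1/2) times
  a power series in 1/v. The two forms supply complementary roots -s/2. A binomial coefficient
  vanishes when its upper argument is a natural number smaller than the lower one, and the upper
  argument at x = -s/2 is an integer for even s in the first form and for odd s in the second. The
  point x = 0 is convenient for the same reason: row i vanishes there in all columns n <= i.\<close>

lemma lozenge_iff:
  "lozenge L \<longleftrightarrow> (\<exists>p q. L = {Up p q, Down p q} \<or> L = {Up p q, Down (p - 1) q}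
      \<or> L = {Up p q, Down p (q - 1)})"
proof
  assume "lozenge L"
  then obtain s t where st: "s \<noteq> t" "edges s \<inter> edges t \<noteq> {}" "L = {s, t}"
    by (auto simp: lozenge_def)
  have up: "edges (Up p q) \<inter> edges (Down p' q') \<noteq> {} \<Longrightarrow>
      (p', q') = (p, q) \<or> (p', q') = (p - 1, q) \<or> (p', q') = (p, q - 1)" for p q p' q'
    by (auto simp: edges_Up edges_Down doubleton_eq_iff)
  have upup: "edges (Up p q) \<inter> edges (Up p' q') \<noteq> {} \<Longrightarrow> p = p' \<and> q = q'" for p q p' q'
    by (auto simp: edges_Up doubleton_eq_iff)
  have dd: "edges (Down p q) \<inter> edges (Down p' q') \<noteq> {} \<Longrightarrow> p = p' \<and> q = q'" for p q p' q'
    by (auto simp: edges_Down doubleton_eq_iff)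
  show "\<exists>p q. L = {Up p q, Down p q} \<or> L = {Up p q, Down (p - 1) q} \<or> L = {Up p q, Down p (q - 1)}"
  proof (cases s)
    case (Up p q)
    then obtain p' q' where "t = Down p' q'"
      using st upup by (cases t) blast+
    then show ?thesis using Up st up by blast
  next
    case (Down p' q')
    then obtain p q where t: "t = Up p q"
      using st dd by (cases t) blast+
    then have "edges (Up p q) \<inter> edges (Down p' q') \<noteq> {}" using st Down by blast
    then show ?thesis using Down st up[of p q p' q'] t by (auto simp: insert_commute)
  qed
next
  assume "\<exists>p q. L = {Up p q, Down p q} \<or> L = {Up p q, Down (p - 1) q} \<or> L = {Up p q, Down p (q - 1)}"
  then obtain p q where "L = {Up p q, Down p q} \<or> L = {Up p q, Down (p - 1) q}
      \<or> L = {Up p q, Down p (q - 1)}" by blast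
  moreover have "edges (Up p q) \<inter> edges (Down p q) \<noteq> {}"
    "edges (Up p q) \<inter> edges (Down (p - 1) q) \<noteq> {}"
    "edges (Up p q) \<inter> edges (Down p (q - 1)) \<noteq> {}"
    by (simp_all add: edges_Up edges_Down)
  ultimately show "lozenge L" unfolding lozenge_def by blast
qed

lemma tilings_empty: "tilings {} = {{}}"
  by (auto simp: tilings_def partition_on_empty)

lemma matching_gf_empty [simp]: "matching_gf w {} = 1"
  by (simp add: matching_gf_def tilings_empty)

lemma finite_tilings:
  assumes "finite R"
  shows "finite (tilings R)"
proof (rule finite_subset)
  show "tilings R \<subseteq> Pow (Pow R)" by (auto simp: tilings_def partition_on_def)
qed (use assms in simp)

lemma insert_in_tilings_iff:
  assumes "L \<subseteq> R" "lozenge L" "L \<notin> T"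
  shows "insert L T \<in> tilings R \<longleftrightarrow> T \<in> tilings (R - L)"
proof -
  have "L \<noteq> {}" using assms(2) by (auto simp: lozenge_iff)
  have "partition_on R (insert L T) \<longleftrightarrow> partition_on (R - L) T"
  proof (cases "L \<inter> \<Union> T = {}")
    case True
    then have "disjnt L A" if "A \<in> T" for A
      using that by (auto simp: disjnt_def)
    then have "disjoint (insert L T) \<longleftrightarrow> disjoint T"
      by (auto simp: pairwise_insert disjnt_sym)
    moreover have "\<Union> (insert L T) = R \<longleftrightarrow> \<Union> T = R - L"
      using True assms(1) by auto
    ultimately show ?thesis using \<open>L \<noteq> {}\<close> by (simp add: partition_on_def)
  next
    case False
    then obtain A where "A \<in> T" "\<not> disjnt L A" by (auto simp: disjnt_def)
    then have "\<not> disjoint (insert L T)"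
      using assms(3) by (auto simp: pairwise_insert)
    moreover have "\<Union> T \<noteq> R - L" using False by blast
    ultimately show ?thesis by (simp add: partition_on_def)
  qed
  then show ?thesis using assms(2) by (auto simp: tilings_def)
qed

text \<open>Each tiling covers t by exactly one lozenge, so the tilings are sorted by the partner s
  of t. Together with the empty region, this recursion is all that the path argument uses about
  tilings.\<close>

lemma matching_gf_remove:
  assumes "finite R" "t \<in> R"
  shows "matching_gf w R = (\<Sum>s | s \<in> R \<and> lozenge {s, t}. w {s, t} * matching_gf w (R - {s, t}))"
proof -
  let ?N = "{s. s \<in> R \<and> lozenge {s, t}}"
  let ?B = "\<lambda>s. insert {s, t} ` tilings (R - {s, t})"
  have notin: "{s, t} \<notin> T" if "T \<in> tilings (R - {s, t})" for s T
    using that by (auto simp: tilings_def partition_on_def)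
  have U: "tilings R = (\<Union>s\<in>?N. ?B s)"
  proof (intro equalityI subsetI)
    fix T assume T: "T \<in> tilings R"
    then obtain L where L: "L \<in> T" "t \<in> L"
      using assms(2) by (auto simp: tilings_def partition_on_def)
    then have "lozenge L" "L \<subseteq> R" using T by (auto simp: tilings_def partition_on_def)
    then obtain s where s: "L = {s, t}"
      using L(2) unfolding lozenge_def by (metis empty_iff insert_commute insert_iff)
    have "insert L (T - {L}) = T" using L by blast
    then have "T - {L} \<in> tilings (R - L)"
      using insert_in_tilings_iff[OF \<open>L \<subseteq> R\<close> \<open>lozenge L\<close>, of "T - {L}"] T by simp
    then have "T \<in> ?B s" using \<open>insert L (T - {L}) = T\<close> unfolding s by (metis imageI)
    then show "T \<in> (\<Union>s\<in>?N. ?B s)" using \<open>lozenge L\<close> \<open>L \<subseteq> R\<close> s by blast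
  next
    fix T assume "T \<in> (\<Union>s\<in>?N. ?B s)"
    then obtain s T' where s: "s \<in> R" "lozenge {s, t}" "T' \<in> tilings (R - {s, t})"
      "T = insert {s, t} T'" by blast
    then show "T \<in> tilings R"
      using insert_in_tilings_iff[of "{s, t}" R T'] notin assms(2) by auto
  qed
  have "?B s \<inter> ?B s' = {}" if "s \<in> ?N" "s' \<in> ?N" "s \<noteq> s'" for s s'
  proof (rule ccontr)
    assume "?B s \<inter> ?B s' \<noteq> {}"
    then obtain T where "T \<in> ?B s" "T \<in> ?B s'" by blast
    then have "T \<in> tilings R" unfolding U using that(1) by (rule_tac UN_I)
    then have "disjoint T" by (simp add: tilings_def partition_on_def)
    moreover have "{s, t} \<in> T" using \<open>T \<in> ?B s\<close> by (elim imageE) simp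
    moreover have "{s', t} \<in> T" using \<open>T \<in> ?B s'\<close> by (elim imageE) simp
    ultimately have "{s, t} = {s', t}"
      using disjointD[of T "{s, t}" "{s', t}"] by blast
    then show False using that(3) by (auto simp: doubleton_eq_iff)
  qed
  then have sum_B: "matching_gf w R = (\<Sum>s\<in>?N. \<Sum>T\<in>?B s. \<Prod>L\<in>T. w L)"
    unfolding matching_gf_def U using assms(1)
    by (intro sum.UNION_disjoint) (auto simp: finite_tilings)
  have "(\<Sum>T\<in>?B s. \<Prod>L\<in>T. w L) = w {s, t} * matching_gf w (R - {s, t})" for s
  proof -
    have inj: "inj_on (insert {s, t}) (tilings (R - {s, t}))"
      using notin by (intro inj_onI) (metis insert_ident)
    have "(\<Sum>T\<in>?B s. \<Prod>L\<in>T. w L) = (\<Sum>T\<in>tilings (R - {s, t}). \<Prod>L\<in>insert {s, t} T. w L)"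
      by (simp add: sum.reindex[OF inj])
    also have "\<dots> = (\<Sum>T\<in>tilings (R - {s, t}). w {s, t} * (\<Prod>L\<in>T. w L))"
    proof (intro sum.cong refl)
      fix T assume T: "T \<in> tilings (R - {s, t})"
      then have "\<Union> T = R - {s, t}" by (auto simp: tilings_def partition_on_def)
      then have "finite T" using assms(1) by (metis finite_Diff finite_UnionD)
      then show "(\<Prod>L\<in>insert {s, t} T. w L) = w {s, t} * (\<Prod>L\<in>T. w L)"
        using notin[OF T] by simp
    qed
    finally show ?thesis by (simp add: matching_gf_def sum_distrib_left)
  qed
  then show ?thesis unfolding sum_B by simp
qed

section \<open>The path determinant\<close>

text \<open>This turns the recursion for the weight of one path into a recursion for the
  determinant: when a head moves, only its row changes.\<close>

lemma det_row_linear: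
  fixes B C :: "nat \<Rightarrow> 'a :: comm_ring_1"
  assumes k: "k < n"
  shows "det (mat n n (\<lambda>(i, c). if i = k then \<alpha> * B c + \<beta> * C c else G i c)) =
      \<alpha> * det (mat n n (\<lambda>(i, c). if i = k then B c else G i c))
    + \<beta> * det (mat n n (\<lambda>(i, c). if i = k then C c else G i c))"
proof -
  have *: "(\<Prod>i = 0..<n. mat n n (\<lambda>(i, c). if i = k then X c else G i c) $$ (i, p i))
      = X (p k) * (\<Prod>i\<in>{0..<n} - {k}. G i (p i))" if "p permutes {0..<n}" for p X
  proof -
    have p: "p i < n" if "i < n" for i
      using permutes_in_image[OF \<open>p permutes {0..<n}\<close>, of i] that by simp
    show ?thesis using k p
      by (subst prod.remove[of _ k]) (auto intro!: prod.cong)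
  qed
  show ?thesis
    unfolding det_def'[OF mat_carrier] sum_distrib_left sum.distrib[symmetric]
  proof (intro sum.cong refl)
    fix p assume "p \<in> {p. p permutes {0..<n}}"
    then have p: "p permutes {0..<n}" by simp
    show "signof p * (\<Prod>i = 0..<n. mat n n (\<lambda>(i, c). if i = k then \<alpha> * B c + \<beta> * C c else G i c) $$ (i, p i))
      = \<alpha> * (signof p * (\<Prod>i = 0..<n. mat n n (\<lambda>(i, c). if i = k then B c else G i c) $$ (i, p i)))
      + \<beta> * (signof p * (\<Prod>i = 0..<n. mat n n (\<lambda>(i, c). if i = k then C c else G i c) $$ (i, p i)))"
      unfolding *[OF p] by (simp add: distrib_left distrib_right mult_ac)
  qed
qed

text \<open>
  A point (p, q) stands both for \<open>Up p q\<close> and \<open>Down p q\<close>. A path enters \<open>Up p q\<close>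
  across the edge that it shares with \<open>Down p q\<close> and continues to \<open>Down (p - 1) q\<close> or
  \<open>Down p (q - 1)\<close>; it ends at a point of \<open>ends\<close>, whose down triangle has a zigzag edge as
  its west side. In \<open>sites_region r V H\<close> the paths have been cut at their current heads H, whose
  down triangles are already covered.
\<close>

definition ends :: "nat \<Rightarrow> point set" where
  "ends r = (\<lambda>i. (- int i - 1, 2 * int i)) ` {..<r}"

definition sites_region :: "nat \<Rightarrow> point set \<Rightarrow> point set \<Rightarrow> triangle set" where
  "sites_region r V H =
     {Up p q | p q. (p, q) \<in> V} \<union> {Down p q | p q. (p, q) \<in> V \<union> ends r - H}"

text \<open>
  Paths with w west and s south steps ending on the zigzag; a south step that ends there is a bump.
\<close>

definition path_gf :: "int \<Rightarrow> int \<Rightarrow> real" where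
  "path_gf w s = (if w < 0 \<or> s < 0 then 0 else if w = 0 \<and> s = 0 then 1
     else real (nat (w + s - 1) choose nat s)
       + (if s = 0 then 0 else real (nat (w + s - 1) choose nat (s - 1)) / 2))"

text \<open>For a path from (p, q) to any of the ends, 2 w + s is 2 p + q + 2, so at a given head
  all columns obey the same rule. The value 0 means that the zigzag is reached, the value 1 that
  only the south step inside a bump is possible.\<close>

lemma path_gf_end: "2 * w + s = 0 \<Longrightarrow> path_gf w s = (if s = 0 then 1 else 0)"
  by (auto simp: path_gf_def)

lemma path_gf_bump: "2 * w + s = 1 \<Longrightarrow> path_gf w s = 1 / 2 * path_gf w (s - 1)"
  by (cases "w = 0 \<and> s = 1") (auto simp: path_gf_def)

text \<open>Pascal's rule for the first step; the hypothesis keeps it away from the final step of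
  weight 1/2.\<close>

lemma path_gf_step:
  assumes "2 * w + s \<ge> 2"
  shows "path_gf w s = path_gf (w - 1) s + path_gf w (s - 1)"
proof (cases "w < 0 \<or> s < 0")
  case True
  then show ?thesis by (auto simp: path_gf_def)
next
  case False
  define m n where "m = nat w" and "n = nat s"
  have mn: "w = int m" "s = int n" using False by (auto simp: m_def n_def)
  show ?thesis
  proof (cases m)
    case 0
    \<comment> \<open>For w = 0 the hypothesis gives s >= 2, so the south step split off is not the
      weighted one.\<close>
    then obtain n' where n': "n = Suc (Suc n')" using assms mn by (cases n; cases "n - 1") auto
    show ?thesis by (simp add: mn 0 n' path_gf_def nat_add_distrib)
  next
    case (Suc m')
    show ?thesis
    proof (cases n)
      case 0
      then show ?thesis using Suc by (simp add: mn path_gf_def)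
    next
      case n: (Suc n')
      have e: "nat (int m + int n - 1) = Suc (m' + n')" "nat (int m - 1 + int n - 1) = m' + n'"
        "nat (int m + (int n - 1) - 1) = m' + n'" "nat (int n) = Suc n'" "nat (int n - 1) = n'"
        "nat (int n - 1 - 1) = n' - 1"
        using Suc n by auto
      have "path_gf w s = real (Suc (m' + n') choose Suc n') + real (Suc (m' + n') choose n') / 2"
        unfolding path_gf_def mn e using Suc n by simp
      moreover have "path_gf (w - 1) s = real (m' + n' choose Suc n') + real (m' + n' choose n') / 2"
        unfolding path_gf_def mn e using Suc n by simp
      moreover have "path_gf w (s - 1) = real (m' + n' choose n')
          + (if n' = 0 then 0 else real (m' + n' choose (n' - 1)) / 2)"
        unfolding path_gf_def mn e using Suc n by simp
      ultimately show ?thesis by (cases n') (simp_all add: add_divide_distrib)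
    qed
  qed
qed

lemma mem_ends: "(p, q) \<in> ends r \<longleftrightarrow> (2 * p + q = -2 \<and> 0 \<le> q \<and> q < 2 * int r)"
proof
  assume "2 * p + q = -2 \<and> 0 \<le> q \<and> q < 2 * int r"
  then show "(p, q) \<in> ends r" unfolding ends_def
    by (intro image_eqI[of _ _ "nat (- p - 1)"]) auto
qed (auto simp: ends_def)

lemma Up_in_sites_region [simp]: "Up p q \<in> sites_region r V H \<longleftrightarrow> (p, q) \<in> V"
  by (simp add: sites_region_def)

lemma Down_in_sites_region [simp]:
  "Down p q \<in> sites_region r V H \<longleftrightarrow> (p, q) \<in> V \<union> ends r \<and> (p, q) \<notin> H"
  by (simp add: sites_region_def)

lemma finite_sites_region:
  assumes "finite V"
  shows "finite (sites_region r V H)"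
proof (rule finite_subset)
  show "sites_region r V H \<subseteq> case_prod Up ` V \<union> case_prod Down ` (V \<union> ends r)"
    unfolding sites_region_def by (safe; simp add: pair_imageI)
  show "finite (case_prod Up ` V \<union> case_prod Down ` (V \<union> ends r))"
    using assms by (simp add: ends_def)
qed

lemma sites_region_eqI:
  assumes "\<And>p q. Up p q \<in> R \<longleftrightarrow> (p, q) \<in> V"
    and "\<And>p q. Down p q \<in> R \<longleftrightarrow> (p, q) \<in> V \<union> ends r \<and> (p, q) \<notin> H"
  shows "R = sites_region r V H"
proof (rule Set.set_eqI)
  fix t show "t \<in> R \<longleftrightarrow> t \<in> sites_region r V H"
    by (cases t) (use assms in auto)
qed

text \<open>When no sites are left, the r heads sit on the r ends in order of decreasing height;
  this pins down which head is where and makes the path matrix the identity.\<close>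

lemma strict_decreasing_rev:
  fixes g :: "nat \<Rightarrow> nat"
  assumes "\<And>i. i < r \<Longrightarrow> g i < r" and "\<And>i i'. i < i' \<Longrightarrow> i' < r \<Longrightarrow> g i' < g i" and "i < r"
  shows "g i = r - 1 - i"
proof -
  have "g i + i \<le> r - 1" if "i < r" for i using that
  proof (induction i)
    case 0
    then show ?case using assms(1)[of 0] by simp
  next
    case (Suc i)
    then show ?case using assms(2)[of i "Suc i"] by simp
  qed
  from this[OF assms(3)] have "g i + i \<le> r - 1" .
  moreover have "i \<le> g (r - 1 - i)" if "i < r" for i using that
  proof (induction i)
    case (Suc i)
    have "r - 1 - Suc i < r - 1 - i" "r - 1 - i < r" using Suc.prems by auto
    then show ?case using Suc assms(2)[of "r - 1 - Suc i" "r - 1 - i"] by simp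
  qed simp
  from this[of "r - 1 - i"] have "r - 1 - i \<le> g i" using assms(3) by simp
  ultimately show ?thesis by linarith
qed

lemma lozenge_Up_Down:
  "lozenge {Down p' q', Up p q} \<longleftrightarrow> (p', q') \<in> {(p, q), (p - 1, q), (p, q - 1)}"
  "lozenge {Up p q, Down p' q'} \<longleftrightarrow> (p', q') \<in> {(p, q), (p - 1, q), (p, q - 1)}"
  "\<not> lozenge {Up p q, Up p' q'}" "\<not> lozenge {Down p q, Down p' q'}"
  by (auto simp: lozenge_iff doubleton_eq_iff)

text \<open>
  The Lindstrom-Gessel-Viennot lemma, one site at a time. Processing the sites by decreasing p + q
  and then increasing q keeps the heads in a fixed order, or makes two of them coincide (and the
  determinant vanish), so no signs occur.
\<close>

lemma matching_gf_sites_region_det: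
  assumes "finite V"
    and V: "\<And>p q. (p, q) \<in> V \<Longrightarrow> 0 \<le> q \<and> 2 * p + q \<ge> -1"
    and W: "\<And>p q. (p, q) \<in> V \<Longrightarrow> 2 * p + q \<ge> 0 \<Longrightarrow> (p - 1, q) \<in> V \<union> ends r"
    and S: "\<And>p q. (p, q) \<in> V \<Longrightarrow> q \<ge> 1 \<Longrightarrow> (p, q - 1) \<in> V \<union> ends r"
    and h: "\<And>i. i < r \<Longrightarrow> h i \<in> V \<union> ends r"
    and mono: "\<And>i i'. i < i' \<Longrightarrow> i' < r \<Longrightarrow> snd (h i') < snd (h i)"
    and diag: "\<And>i p q. i < r \<Longrightarrow> (p, q) \<in> V \<Longrightarrow> fst (h i) + snd (h i) \<ge> p + q - 1"
    and w1: "\<And>p q. w {Up p q, Down p q} = 1"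
    and w2: "\<And>p q. w {Up p q, Down (p - 1) q} = 1"
    and w3: "\<And>p q. 2 * p + q \<ge> 0 \<Longrightarrow> w {Up p q, Down p (q - 1)} = 1"
    and w4: "\<And>p q. (p, q) \<in> V \<Longrightarrow> 2 * p + q = -1 \<Longrightarrow> w {Up p q, Down p (q - 1)} = 1 / 2"
  shows "matching_gf w (sites_region r V (h ` {..<r})) =
    det (mat r r (\<lambda>(i, c). path_gf (fst (h i) + int (r - c)) (snd (h i) - 2 * int (r - 1 - c))))"
  using assms(1-7) w4
proof (induction "card V" arbitrary: V h)
  case 0
  then have [simp]: "V = {}" by simp
  define g where "g = (\<lambda>i. nat (- fst (h i) - 1))"
  have hg: "h i = (- int (g i) - 1, 2 * int (g i))" "g i < r" if "i < r" for i
    using "0.prems"(5)[OF that] by (auto simp: ends_def g_def)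
  have "g i' < g i" if "i < i'" "i' < r" for i i'
    using "0.prems"(6)[OF that] hg[of i] hg[of i'] that by simp
  then have g: "g i = r - 1 - i" if "i < r" for i
    using strict_decreasing_rev[of r g i] hg that by blast
  have "h ` {..<r} = ends r"
  proof
    show "h ` {..<r} \<subseteq> ends r" using "0.prems"(5) by auto
    show "ends r \<subseteq> h ` {..<r}"
    proof
      fix z assume "z \<in> ends r"
      then obtain i where i: "i < r" "z = (- int i - 1, 2 * int i)" by (auto simp: ends_def)
      then have "z = h (r - 1 - i)" using hg(1)[of "r - 1 - i"] g[of "r - 1 - i"] by auto
      then show "z \<in> h ` {..<r}" using i by auto
    qed
  qed
  then have "sites_region r V (h ` {..<r}) = {}" by (simp add: sites_region_def)
  moreover have "mat r r (\<lambda>(i, c). path_gf (fst (h i) + int (r - c)) (snd (h i) - 2 * int (r - 1 - c)))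
      = (1\<^sub>m r :: real mat)"
  proof (rule eq_matI)
    fix i c assume ic: "i < dim_row (1\<^sub>m r :: real mat)" "c < dim_col (1\<^sub>m r :: real mat)"
    then have "path_gf (fst (h i) + int (r - c)) (snd (h i) - 2 * int (r - 1 - c)) =
        path_gf (int i - int c) (2 * (int c - int i))"
      using hg(1)[of i] g[of i] by (simp add: of_nat_diff)
    also have "\<dots> = (if i = c then 1 else 0)" by (subst path_gf_end) auto
    finally show "mat r r (\<lambda>(i, c). path_gf (fst (h i) + int (r - c)) (snd (h i) - 2 * int (r - 1 - c)))
      $$ (i, c) = (1\<^sub>m r :: real mat) $$ (i, c)" using ic by simp
  qed simp_all
  ultimately show ?case by simp
next
  case (Suc m)
  note V = Suc.prems(2) and W = Suc.prems(3) and S = Suc.prems(4) and h = Suc.prems(5)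
    and mono = Suc.prems(6) and diag = Suc.prems(7) and w4 = Suc.prems(8)
  let ?F = "\<lambda>z c. path_gf (fst z + int (r - c)) (snd z - 2 * int (r - 1 - c))"
  let ?R = "\<lambda>V h. sites_region r V (h ` {..<r})"
  have "V \<noteq> {}" using Suc.hyps(2) by auto
  define D where "D = Max ((\<lambda>(p, q). p + q) ` V)"
  have D: "p + q \<le> D" if "(p, q) \<in> V" for p q
    unfolding D_def using Suc.prems(1) that by (intro Max_ge) force+
  define Q where "Q = Min (snd ` {z \<in> V. fst z + snd z = D})"
  have "D \<in> (\<lambda>(p, q). p + q) ` V"
    unfolding D_def using Suc.prems(1) \<open>V \<noteq> {}\<close> by (intro Max_in) auto
  then have "snd ` {z \<in> V. fst z + snd z = D} \<noteq> {}" by auto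
  then have "Q \<in> snd ` {z \<in> V. fst z + snd z = D}"
    unfolding Q_def using Suc.prems(1) by (intro Min_in) auto
  then obtain P where A: "(P, Q) \<in> V" "P + Q = D" by auto
  have Qmin: "Q \<le> q" if "(p, q) \<in> V" "p + q = D" for p q
    unfolding Q_def using Suc.prems(1) that by (intro Min_le) force+
  have Aend: "(P, Q) \<notin> ends r" using V[OF A(1)] by (auto simp: mem_ends)
  let ?V = "V - {(P, Q)}"
  have finR: "finite (?R V h)" using Suc.prems(1) by (rule finite_sites_region)
  have IH: "matching_gf w (?R ?V h') = det (mat r r (\<lambda>(i, c). ?F (h' i) c))"
    if "\<And>i. i < r \<Longrightarrow> h' i \<in> ?V \<union> ends r"
      and "\<And>i i'. i < i' \<Longrightarrow> i' < r \<Longrightarrow> snd (h' i') < snd (h' i)"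
      and "\<And>i p q. i < r \<Longrightarrow> (p, q) \<in> V \<Longrightarrow> fst (h' i) + snd (h' i) \<ge> p + q - 1" for h'
  proof (rule Suc.hyps(1))
    show "m = card ?V" using Suc.hyps(2) Suc.prems(1) A(1) by simp
    show "(p - 1, q) \<in> ?V \<union> ends r" if "(p, q) \<in> ?V" "0 \<le> 2 * p + q" for p q
      using W[of p q] D[of p q] that A(2) by auto
    show "(p, q - 1) \<in> ?V \<union> ends r" if "(p, q) \<in> ?V" "1 \<le> q" for p q
      using S[of p q] D[of p q] that A(2) by auto
  qed (use Suc.prems(1) V w4 that in auto)
  show ?case
  proof (cases "(P, Q) \<in> h ` {..<r}")
    case False
    \<comment> \<open>The other two neighbours of \<open>Down P Q\<close> would be sites on the
      diagonal D + 1, so the lozenge is forced.\<close>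
    have nb: "{s. s \<in> ?R V h \<and> lozenge {s, Down P Q}} = {Up P Q}"
    proof (intro equalityI subsetI)
      fix s assume "s \<in> {s. s \<in> ?R V h \<and> lozenge {s, Down P Q}}"
      then show "s \<in> {Up P Q}"
        using D[of "P + 1" Q] D[of P "Q + 1"] A(2)
        by (cases s) (auto simp: lozenge_Up_Down)
    qed (use A in \<open>auto simp: lozenge_Up_Down\<close>)
    have "matching_gf w (?R V h) = w {Up P Q, Down P Q} * matching_gf w (?R V h - {Up P Q, Down P Q})"
      using False A by (subst matching_gf_remove[OF finR, of "Down P Q"]) (auto simp: nb)
    also have "?R V h - {Up P Q, Down P Q} = ?R ?V h"
      by (rule sites_region_eqI) (use Aend in auto)
    also have "matching_gf w (?R ?V h) = det (mat r r (\<lambda>(i, c). ?F (h i) c))"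
    proof (rule IH)
      show "h i \<in> ?V \<union> ends r" if "i < r" for i
        using h[OF that] False that by (metis DiffI Un_iff imageI lessThan_iff singletonD)
    qed (use mono diag in auto)
    finally show ?thesis by (simp add: w1)
  next
    case True
    then obtain k where k: "k < r" "h k = (P, Q)" by auto
    have other: "h i \<noteq> (P, Q)" if "i < r" "i \<noteq> k" for i
      using mono[of i k] mono[of k i] k that by (cases "i < k") auto
    have R': "?R V h - {Down p' q', Up P Q} = ?R ?V (h(k := (p', q')))"
      if "(p', q') \<noteq> (P, Q)" for p' q'
    proof (rule sites_region_eqI)
      have "h ` ({..<r} - {k}) = h ` {..<r} - {(P, Q)}"
      proof (intro equalityI subsetI)
        fix z assume "z \<in> h ` {..<r} - {(P, Q)}"
        then obtain i where i: "z = h i" "i < r" "z \<noteq> (P, Q)" by (elim DiffE imageE) simp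
        then have "i \<noteq> k" using k by metis
        then show "z \<in> h ` ({..<r} - {k})" using i by simp
      next
        fix z assume "z \<in> h ` ({..<r} - {k})"
        then obtain i where i: "z = h i" "i < r" "i \<noteq> k" by (elim imageE) simp
        then show "z \<in> h ` {..<r} - {(P, Q)}" using other[of i] by simp
      qed
      then have "h(k := (p', q')) ` {..<r} = insert (p', q') (h ` {..<r} - {(P, Q)})"
        unfolding fun_upd_image using k(1) by (simp only: lessThan_iff if_True)
      then show "Down p q \<in> ?R V h - {Down p' q', Up P Q}
          \<longleftrightarrow> (p, q) \<in> ?V \<union> ends r \<and> (p, q) \<notin> h(k := (p', q')) ` {..<r}" for p q
        using that True Aend by auto
    qed auto
    \<comment> \<open>The triangle \<open>Down P Q\<close> is already covered, so the path must
      leave west or south. The west triangle cannot be the position of another head, because heads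
      have distinct heights; the south one can.\<close>
    have nb: "{s. s \<in> ?R V h \<and> lozenge {s, Up P Q}} =
        (if 2 * P + Q \<ge> 0 then {Down (P - 1) Q} else {})
        \<union> (if Q \<ge> 1 \<and> (P, Q - 1) \<notin> h ` {..<r} then {Down P (Q - 1)} else {})" (is "?l = ?r")
    proof (intro equalityI subsetI)
      fix s assume "s \<in> ?l"
      then show "s \<in> ?r"
        using True V[of "P - 1" Q] V[of P "Q - 1"]
        by (cases s) (auto simp: lozenge_Up_Down mem_ends)
    next
      fix s assume s: "s \<in> ?r"
      have "(P - 1, Q) \<notin> h ` {..<r}"
      proof
        assume "(P - 1, Q) \<in> h ` {..<r}"
        then obtain i where "i < r" "h i = (P - 1, Q)" by auto
        then show False using mono[of i k] mono[of k i] k by (cases i k rule: linorder_cases) auto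
      qed
      then show "s \<in> ?l" using s W[OF A(1)] S[OF A(1)]
        by (auto simp: lozenge_Up_Down split: if_splits)
    qed
    have row: "det (mat r r (\<lambda>(i, c). if i = k then X c else ?F (h i) c)) =
        det (mat r r (\<lambda>(i, c). ?F ((h(k := z)) i) c))" if "\<And>c. c < r \<Longrightarrow> X c = ?F z c" for X z
      by (intro arg_cong[of _ _ det] cong_mat) (use that in auto)
    have row0: "det (mat r r (\<lambda>(i, c). ?F (h i) c)) =
        det (mat r r (\<lambda>(i, c). if i = k then ?F (P, Q) c else ?F (h i) c))"
      by (intro arg_cong[of _ _ det] cong_mat) (use k in auto)
    have row2: "det (mat r r (\<lambda>(i, c). ?F ((h(k := z)) i) c)) =
        det (mat r r (\<lambda>(i, c). if i = k then ?F z c else ?F (h i) c))" for z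
      by (rule row[symmetric]) (rule refl)
    have west: "matching_gf w (?R ?V (h(k := (P - 1, Q)))) =
        det (mat r r (\<lambda>(i, c). ?F ((h(k := (P - 1, Q))) i) c))" if "2 * P + Q \<ge> 0"
    proof (rule IH)
      show "(h(k := (P - 1, Q))) i \<in> ?V \<union> ends r" if "i < r" for i
        using W[OF A(1) \<open>2 * P + Q \<ge> 0\<close>] h[of i] other[of i] that by auto
      show "snd ((h(k := (P - 1, Q))) i') < snd ((h(k := (P - 1, Q))) i)" if "i < i'" "i' < r" for i i'
        using mono[OF that] k that by auto
      show "p + q - 1 \<le> fst ((h(k := (P - 1, Q))) i) + snd ((h(k := (P - 1, Q))) i)"
        if "i < r" "(p, q) \<in> V" for i p q
        using diag[OF that] D[OF that(2)] A(2) by auto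
    qed
    \<comment> \<open>A head at height Q - 1 that is not exactly south of (P, Q) would lie further
      east. As a site it would contradict the maximality of D or the minimality of Q; as an end it
      would be too far from the zigzag.\<close>
    have collide: "snd (h i) \<noteq> Q - 1" if "i < r" "(P, Q - 1) \<notin> h ` {..<r}" for i
    proof
      assume q: "snd (h i) = Q - 1"
      define p where "p = fst (h i)"
      have hi: "h i = (p, Q - 1)" using q by (simp add: p_def prod_eq_iff)
      have d: "p + Q - 1 \<ge> D - 1" using diag[OF that(1) A(1)] hi A(2) by simp
      have "p \<noteq> P" using that hi by force
      have "p > P" using d A(2) \<open>p \<noteq> P\<close> by simp
      have "h i \<in> V \<union> ends r" using h that(1) by blast
      then show False
      proof
        assume "h i \<in> V"
        then have "p + (Q - 1) \<le> D" using D hi by simp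
        then have "p + (Q - 1) = D" using \<open>p > P\<close> A(2) by simp
        then show False using Qmin[of p "Q - 1"] \<open>h i \<in> V\<close> hi by simp
      next
        assume "h i \<in> ends r"
        then show False using V[OF A(1)] \<open>p > P\<close> hi by (auto simp: mem_ends)
      qed
    qed
    have south: "matching_gf w (?R ?V (h(k := (P, Q - 1)))) =
        det (mat r r (\<lambda>(i, c). ?F ((h(k := (P, Q - 1))) i) c))"
      if "Q \<ge> 1" "(P, Q - 1) \<notin> h ` {..<r}"
    proof (rule IH)
      show "(h(k := (P, Q - 1))) i \<in> ?V \<union> ends r" if "i < r" for i
        using S[OF A(1) \<open>Q \<ge> 1\<close>] h[of i] other[of i] that by auto
      show "snd ((h(k := (P, Q - 1))) i') < snd ((h(k := (P, Q - 1))) i)" if "i < i'" "i' < r" for i i'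
        using mono[OF that] k that collide[OF _ \<open>(P, Q - 1) \<notin> h ` {..<r}\<close>, of i']
          collide[OF _ \<open>(P, Q - 1) \<notin> h ` {..<r}\<close>, of i] by auto
      show "p + q - 1 \<le> fst ((h(k := (P, Q - 1))) i) + snd ((h(k := (P, Q - 1))) i)"
        if "i < r" "(p, q) \<in> V" for i p q
        using diag[OF that] D[OF that(2)] A(2) by auto
    qed
    \<comment> \<open>A blocked south step yields no tiling, and correspondingly two rows coincide:
      this is where intersecting paths cancel.\<close>
    have same: "det (mat r r (\<lambda>(i, c). ?F ((h(k := (P, Q - 1))) i) c)) = 0"
      if hit: "(P, Q - 1) \<in> h ` {..<r}"
    proof -
      obtain i where i: "i < r" "h i = (P, Q - 1)" using hit by auto
      then have "i \<noteq> k" using k by auto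
      show ?thesis
      proof (rule det_identical_rows[OF _ \<open>i \<noteq> k\<close> i(1) k(1)])
        show "row (mat r r (\<lambda>(i, c). ?F ((h(k := (P, Q - 1))) i) c)) i =
            row (mat r r (\<lambda>(i, c). ?F ((h(k := (P, Q - 1))) i) c)) k"
          by (rule eq_vecI) (use i k \<open>i \<noteq> k\<close> in auto)
      qed simp
    qed
    \<comment> \<open>From height 0 a south step leaves the region; the weights agree because s
      becomes negative for every end.\<close>
    have below: "?F (P, Q - 1) c = 0" if "Q < 1" for c
      using V[OF A(1)] that by (simp add: path_gf_def)
    define \<sigma> where "\<sigma> = (if Q \<ge> 1 \<and> (P, Q - 1) \<notin> h ` {..<r}
      then matching_gf w (?R ?V (h(k := (P, Q - 1)))) else 0)"
    have \<sigma>: "\<sigma> = det (mat r r (\<lambda>(i, c). ?F ((h(k := (P, Q - 1))) i) c))"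
    proof (cases "Q \<ge> 1")
      case True
      then show ?thesis using south same by (auto simp: \<sigma>_def)
    next
      case False
      then have "Q < 1" by simp
      have "det (mat r r (\<lambda>(i, c). ?F ((h(k := (P, Q - 1))) i) c)) =
        det (mat r r (\<lambda>(i, c). if i = k then 0 * 0 + 0 * 0 else ?F (h i) c))"
        by (rule row[symmetric, of "\<lambda>c. 0 * 0 + 0 * 0" "(P, Q - 1)"])
          (simp only: below[OF \<open>Q < 1\<close>] mult_zero_left add_0)
      also have "\<dots> = 0" by (subst det_row_linear[OF k(1)]) simp
      finally show ?thesis using False by (simp add: \<sigma>_def)
    qed
    define G where "G s = w {s, Up P Q} * matching_gf w (?R V h - {s, Up P Q})" for s
    have rm: "matching_gf w (?R V h) = (\<Sum>s | s \<in> ?R V h \<and> lozenge {s, Up P Q}. G s)"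
      unfolding G_def by (rule matching_gf_remove[OF finR]) (use A in simp)
    have w2': "w {Down (P - 1) Q, Up P Q} = 1"
      using w2[of P Q] by (simp add: insert_commute)
    have w3': "w {Down P (Q - 1), Up P Q} = (if 2 * P + Q \<ge> 0 then 1 else 1 / 2)"
      using w3[of P Q] w4[OF A(1)] V[OF A(1)] by (auto simp: insert_commute)
    have GW: "G (Down (P - 1) Q) = matching_gf w (?R ?V (h(k := (P - 1, Q))))"
      unfolding G_def w2' by (subst R') simp_all
    have GS: "G (Down P (Q - 1)) = (if 2 * P + Q \<ge> 0 then 1 else 1 / 2) *
        matching_gf w (?R ?V (h(k := (P, Q - 1))))"
      unfolding G_def w3' by (subst R') simp_all
    show ?thesis
    proof (cases "2 * P + Q \<ge> 0")
      case True
      have "matching_gf w (?R V h) = matching_gf w (?R ?V (h(k := (P - 1, Q)))) + \<sigma>"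
        unfolding rm nb \<sigma>_def using True by (simp add: GW GS)
      also have "\<dots> = 1 * det (mat r r (\<lambda>(i, c). if i = k then ?F (P - 1, Q) c else ?F (h i) c))
         + 1 * det (mat r r (\<lambda>(i, c). if i = k then ?F (P, Q - 1) c else ?F (h i) c))"
        unfolding west[OF True] \<sigma> row2 by (simp only: mult_1_left)
      also have "\<dots> = det (mat r r (\<lambda>(i, c). ?F (h i) c))"
        unfolding det_row_linear[OF k(1), symmetric] row0
      proof (intro arg_cong[of _ _ det] cong_mat refl)
        fix i c assume "i < r" "c < r"
        then have "?F (P, Q) c = 1 * ?F (P - 1, Q) c + 1 * ?F (P, Q - 1) c"
          using True path_gf_step[of "P + int (r - c)" "Q - 2 * int (r - 1 - c)"]
          by (simp add: algebra_simps of_nat_diff)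
        then show "(case (i, c) of (i, c) \<Rightarrow> if i = k then 1 * ?F (P - 1, Q) c + 1 * ?F (P, Q - 1) c
             else ?F (h i) c) = (case (i, c) of (i, c) \<Rightarrow> if i = k then ?F (P, Q) c else ?F (h i) c)"
          by simp
      qed
      finally show ?thesis .
    next
      case False
      then have b: "2 * P + Q = -1" using V[OF A(1)] by simp
      have "matching_gf w (?R V h) = 1 / 2 * \<sigma>"
        unfolding rm nb \<sigma>_def using False by (simp add: GS)
      also have "\<dots> = 1 / 2 * det (mat r r (\<lambda>(i, c). if i = k then ?F (P, Q - 1) c else ?F (h i) c))
         + 0 * det (mat r r (\<lambda>(i, c). if i = k then ?F (P, Q - 1) c else ?F (h i) c))"
        unfolding \<sigma> row2 by (simp only: mult_zero_left add_0_right)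
      also have "\<dots> = det (mat r r (\<lambda>(i, c). ?F (h i) c))"
        unfolding det_row_linear[OF k(1), symmetric] row0
      proof (intro arg_cong[of _ _ det] cong_mat refl)
        fix i c assume "i < r" "c < r"
        then have "?F (P, Q) c = 1 / 2 * ?F (P, Q - 1) c"
          using b path_gf_bump[of "P + int (r - c)" "Q - 2 * int (r - 1 - c)"]
          by (simp add: algebra_simps of_nat_diff)
        then show "(case (i, c) of (i, c) \<Rightarrow> if i = k then 1 / 2 * ?F (P, Q - 1) c + 0 * ?F (P, Q - 1) c
             else ?F (h i) c) = (case (i, c) of (i, c) \<Rightarrow> if i = k then ?F (P, Q) c else ?F (h i) c)"
          by simp
      qed
      finally show ?thesis .
    qed
  qed
qed

section \<open>Two forms of the matrix\<close>

text \<open>The argument y is the length x of the north edge, made real so that the determinant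
  becomes a polynomial in it. The conditions on n guard against truncated subtraction.\<close>

definition bump_entry :: "nat \<Rightarrow> nat \<Rightarrow> real \<Rightarrow> real" where
  "bump_entry i n y = (if n \<le> 2 * i + 2 then (y + real i) gchoose (2 * i + 2 - n) else 0)
     + (if n \<le> 2 * i + 1 then ((y + real i) gchoose (2 * i + 1 - n)) / 2 else 0)"

text \<open>With a formal variable Y, this is the coefficient of Y^(n - 1) in (1 + 1/Y)^y (Y (Y +
  1))^(i + 1/2).\<close>

definition half_entry :: "nat \<Rightarrow> nat \<Rightarrow> real \<Rightarrow> real" where
  "half_entry i n y = (if n \<le> 2 * i + 2 then (y + real i + 1 / 2) gchoose (2 * i + 2 - n) else 0)"

text \<open>
  With v = y (y + 1) and z = 1/y this is (y + 1/2) v^(-1/2) = (1 + 1/(4 v))^(1/2).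
\<close>

lemma fps_sqrt_identity:
  defines "G \<equiv> fps_const (1 / 4) * fps_X ^ 2 * fps_binomial (-1 :: real)"
  shows "(1 + fps_const (1 / 2) * fps_X) * fps_binomial (- 1 / 2) = fps_binomial (1 / 2) oo G"
proof -
  let ?K = "(1 + fps_const (1 / 2) * fps_X) * fps_binomial (- 1 / 2 :: real)"
  let ?H = "fps_binomial (1 / 2) oo G"
  have G0: "fps_nth G 0 = 0" by (simp add: G_def)
  have "?H ^ 2 = (fps_binomial (1 / 2) * fps_binomial (1 / 2)) oo G"
    using G0 by (simp add: fps_compose_mult_distrib power2_eq_square)
  also have "\<dots> = (1 + fps_X) oo G"
    by (simp flip: fps_binomial_add_mult add: fps_binomial_1)
  also have "\<dots> = 1 + G"
    using G0 by (simp add: fps_compose_add_distrib)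
  finally have H: "?H ^ 2 = 1 + G" .
  have q: "fps_const (1 / 2 :: real) + fps_const (1 / 2) = 1"
    unfolding fps_const_add by simp
  have "?K ^ 2 = (1 + fps_const (1 / 2) * fps_X) ^ 2 * fps_binomial (-1)"
    by (simp add: power2_eq_square mult_ac flip: fps_binomial_add_mult)
  also have "(1 + fps_const (1 / 2 :: real) * fps_X) ^ 2 = (1 + fps_X) + fps_const (1 / 4) * fps_X ^ 2"
  proof -
    have "(1 + fps_const (1 / 2 :: real) * fps_X) ^ 2
      = 1 + (fps_const (1 / 2) + fps_const (1 / 2)) * fps_X + (fps_const (1 / 2) * fps_const (1 / 2)) * fps_X ^ 2"
      by (simp only: power2_eq_square algebra_simps mult_1_left mult_1_right)
    then show ?thesis by (simp add: q)
  qed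
  also have "(1 + fps_X + fps_const (1 / 4) * fps_X ^ 2) * fps_binomial (-1 :: real)
      = fps_binomial 1 * fps_binomial (-1) + G"
    by (simp add: fps_binomial_1 G_def algebra_simps)
  also have "fps_binomial 1 * fps_binomial (-1 :: real) = 1"
    by (simp flip: fps_binomial_add_mult)
  finally have "?K ^ 2 = ?H ^ 2" using H by simp
  then have "?K = ?H \<or> ?K = - ?H" by (simp add: power2_eq_iff)
  \<comment> \<open>Equality of the squares leaves a sign open; both constant terms are 1.\<close>
  moreover have "fps_nth ?K 0 \<noteq> fps_nth (- ?H) 0" by (simp add: fps_compose_nth)
  ultimately show ?thesis by metis
qed

text \<open>The left side is the coefficient of z^N in (1 + z/2) (1 + z)^c. Splitting off (1 + z)^(c
  + 1/2) leaves the square root series in G = z^2 / (4 (1 + z)), whose s-th power lowers the upper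
  argument by s and N by 2 s.\<close>

lemma gchoose_half_expansion:
  fixes c :: real
  shows "(c gchoose N) + (if N = 0 then 0 else (c gchoose (N - 1)) / 2)
    = (\<Sum>s\<le>N. if 2 * s \<le> N then ((1 / 2) gchoose s) * (1 / 4) ^ s * ((c + 1 / 2 - real s) gchoose (N - 2 * s)) else 0)"
proof -
  define G where "G = fps_const (1 / 4) * fps_X ^ 2 * fps_binomial (-1 :: real)"
  have "(1 + fps_const (1 / 2) * fps_X) * fps_binomial c
      = ((1 + fps_const (1 / 2) * fps_X) * fps_binomial (- 1 / 2)) * fps_binomial (c + 1 / 2)"
    by (simp add: mult.assoc flip: fps_binomial_add_mult)
  also have "\<dots> = (fps_binomial (1 / 2) oo G) * fps_binomial (c + 1 / 2)"
    unfolding G_def fps_sqrt_identity ..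
  finally have eq: "(1 + fps_const (1 / 2) * fps_X) * fps_binomial c
      = (fps_binomial (1 / 2) oo G) * fps_binomial (c + 1 / 2)" .
  have Gpow: "G ^ s = fps_const ((1 / 4) ^ s) * fps_X ^ (2 * s) * fps_binomial (- real s)" for s
    by (simp add: G_def power_mult_distrib fps_const_power fps_binomial_power power_mult)
  have Gs: "G ^ s * fps_binomial (c + 1 / 2)
      = fps_const ((1 / 4) ^ s) * (fps_X ^ (2 * s) * fps_binomial (c + 1 / 2 - real s))" for s
  proof -
    have "fps_binomial (- real s) * fps_binomial (c + 1 / 2) = fps_binomial (c + 1 / 2 - real s)"
      by (simp flip: fps_binomial_add_mult)
    then show ?thesis by (simp add: Gpow mult.assoc)
  qed
  have G0: "fps_nth (G ^ s) u = 0" if "u < s" for s u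
    using that by (simp add: Gpow mult.assoc fps_X_power_mult_nth)
  have "(c gchoose N) + (if N = 0 then 0 else (c gchoose (N - 1)) / 2)
      = fps_nth ((1 + fps_const (1 / 2) * fps_X) * fps_binomial c) N"
    by (cases N) (auto simp: distrib_right mult.assoc)
  also have "\<dots> = (\<Sum>u=0..N. fps_nth (fps_binomial (1 / 2) oo G) u * fps_nth (fps_binomial (c + 1 / 2)) (N - u))"
    unfolding eq fps_mult_nth ..
  also have "\<dots> = (\<Sum>u=0..N. (\<Sum>s=0..N. ((1 / 2) gchoose s) * fps_nth (G ^ s) u) * fps_nth (fps_binomial (c + 1 / 2)) (N - u))"
  proof (intro sum.cong refl arg_cong2[of _ _ _ _ "(*)"])
    fix u assume u: "u \<in> {0..N}"
    show "fps_nth (fps_binomial (1 / 2) oo G) u = (\<Sum>s=0..N. ((1 / 2) gchoose s) * fps_nth (G ^ s) u)"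
      unfolding fps_compose_nth using u G0
      by (intro sum.mono_neutral_cong_left) auto
  qed
  also have "\<dots> = (\<Sum>s=0..N. ((1 / 2) gchoose s) * (\<Sum>u=0..N. fps_nth (G ^ s) u * fps_nth (fps_binomial (c + 1 / 2)) (N - u)))"
    unfolding sum_distrib_left sum_distrib_right
    by (subst sum.swap) (simp add: mult.assoc)
  also have "\<dots> = (\<Sum>s=0..N. ((1 / 2) gchoose s) * fps_nth (G ^ s * fps_binomial (c + 1 / 2)) N)"
    unfolding fps_mult_nth ..
  also have "\<dots> = (\<Sum>s\<le>N. if 2 * s \<le> N then ((1 / 2) gchoose s) * (1 / 4) ^ s * ((c + 1 / 2 - real s) gchoose (N - 2 * s)) else 0)"
    unfolding Gs by (intro sum.cong) (auto simp: fps_X_power_mult_nth atMost_atLeast0)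
  finally show ?thesis .
qed

text \<open>The highest power of the formal variable in the term with v^(i + 1/2 - s) is 2 i + 1 - 2
  s. It is negative for s > i, while n >= 1 means that column n reads off a nonnegative power; so
  the series stops at s = i and only the rows t <= i occur.\<close>

lemma bump_entry_expansion:
  assumes "n \<ge> 1"
  shows "bump_entry i n y = (\<Sum>t\<le>i. ((1 / 2) gchoose (i - t)) * (1 / 4) ^ (i - t) * half_entry t n y)"
proof -
  have *: "(\<Sum>t\<le>i. ((1 / 2) gchoose (i - t)) * (1 / 4) ^ (i - t) * half_entry t n y)
    = (\<Sum>s\<le>i. ((1 / 2) gchoose s) * (1 / 4) ^ s * half_entry (i - s) n y)"
    by (rule sum.reindex_bij_witness[of _ "\<lambda>s. i - s" "\<lambda>s. i - s"]) auto
  show ?thesis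
  proof (cases "n \<le> 2 * i + 2")
    case True
    let ?N = "2 * i + 2 - n"
    have "bump_entry i n y = ((y + real i) gchoose ?N) + (if ?N = 0 then 0 else ((y + real i) gchoose (?N - 1)) / 2)"
      using True by (auto simp: bump_entry_def)
    also have "\<dots> = (\<Sum>s\<le>?N. if 2 * s \<le> ?N
        then ((1 / 2) gchoose s) * (1 / 4) ^ s * ((y + real i + 1 / 2 - real s) gchoose (?N - 2 * s)) else 0)"
      by (rule gchoose_half_expansion)
    also have "\<dots> = (\<Sum>s | s \<le> i \<and> 2 * s \<le> ?N. ((1 / 2) gchoose s) * (1 / 4) ^ s * ((y + real i + 1 / 2 - real s) gchoose (?N - 2 * s)))"
      using assms by (intro sum.mono_neutral_cong_right) auto
    also have "\<dots> = (\<Sum>s\<le>i. ((1 / 2) gchoose s) * (1 / 4) ^ s * half_entry (i - s) n y)"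
    proof (intro sum.mono_neutral_cong_left ballI)
      fix s assume s: "s \<in> {s. s \<le> i \<and> 2 * s \<le> ?N}"
      then have "n \<le> 2 * (i - s) + 2" "2 * (i - s) + 2 - n = ?N - 2 * s"
        "y + real (i - s) + 1 / 2 = y + real i + 1 / 2 - real s" using True by auto
      then show "((1 / 2) gchoose s) * (1 / 4) ^ s * ((y + real i + 1 / 2 - real s) gchoose (?N - 2 * s))
          = ((1 / 2) gchoose s) * (1 / 4) ^ s * half_entry (i - s) n y"
        unfolding half_entry_def by presburger
    qed (use True in \<open>auto simp: half_entry_def\<close>)
    finally show ?thesis using * by simp
  next
    case False
    then show ?thesis by (auto simp: bump_entry_def half_entry_def intro!: sum.neutral)
  qed
qed

lemma det_bump_half:
  assumes "\<And>l. l < r \<Longrightarrow> \<nu> l \<ge> 1"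
  shows "det (mat r r (\<lambda>(i, l). bump_entry i (\<nu> l) y)) = det (mat r r (\<lambda>(i, l). half_entry i (\<nu> l) y))"
proof -
  define L :: "real mat" where
    "L = mat r r (\<lambda>(i, t). if t \<le> i then ((1 / 2) gchoose (i - t)) * (1 / 4) ^ (i - t) else 0)"
  let ?H = "mat r r (\<lambda>(i, l). half_entry i (\<nu> l) y)"
  have "mat r r (\<lambda>(i, l). bump_entry i (\<nu> l) y) = L * ?H"
  proof (rule eq_matI)
    fix i l assume il: "i < dim_row (L * ?H)" "l < dim_col (L * ?H)"
    then have "i < r" "l < r" by (auto simp: L_def)
    then have "(L * ?H) $$ (i, l) = (\<Sum>t = 0..<r. (if t \<le> i then ((1 / 2) gchoose (i - t)) * (1 / 4) ^ (i - t) else 0) * half_entry t (\<nu> l) y)"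
      by (simp add: L_def scalar_prod_def)
    also have "\<dots> = (\<Sum>t\<le>i. ((1 / 2) gchoose (i - t)) * (1 / 4) ^ (i - t) * half_entry t (\<nu> l) y)"
      using \<open>i < r\<close> by (intro sum.mono_neutral_cong_right) auto
    also have "\<dots> = bump_entry i (\<nu> l) y"
      using bump_entry_expansion[OF assms[OF \<open>l < r\<close>]] by simp
    finally show "mat r r (\<lambda>(i, l). bump_entry i (\<nu> l) y) $$ (i, l) = (L * ?H) $$ (i, l)"
      using \<open>i < r\<close> \<open>l < r\<close> by simp
  qed (auto simp: L_def)
  moreover have "det L = 1"
  proof -
    have "det L = prod_list (diag_mat L)"
      by (rule det_lower_triangular[of r]) (auto simp: L_def)
    also have "diag_mat L = map (\<lambda>_. 1) [0..<r]"
      unfolding diag_mat_def by (intro map_cong) (auto simp: L_def)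
    finally show ?thesis by (simp add: map_replicate_const prod_list_replicate)
  qed
  moreover have "det (L * ?H) = det L * det ?H"
    by (rule det_mult[of _ r]) (auto simp: L_def)
  ultimately show ?thesis by simp
qed

section \<open>The value at x = 0\<close>

lemma det_scale_rows_cols:
  fixes \<alpha> \<beta> :: "nat \<Rightarrow> 'a :: comm_ring_1"
  shows "det (mat n n (\<lambda>(i, c). \<alpha> i * \<beta> c * G i c)) =
    (\<Prod>i<n. \<alpha> i) * (\<Prod>c<n. \<beta> c) * det (mat n n (\<lambda>(i, c). G i c))"
  unfolding det_def'[OF mat_carrier] sum_distrib_left
proof (intro sum.cong refl)
  fix p assume "p \<in> {p. p permutes {0..<n}}"
  then have p: "p permutes {..<n}" by (simp add: atLeast0LessThan)
  then have pr: "p i < n" if "i < n" for i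
    using permutes_in_image[of p "{..<n}" i] that by simp
  have "(\<Prod>i = 0..<n. mat n n (\<lambda>(i, c). \<alpha> i * \<beta> c * G i c) $$ (i, p i))
      = (\<Prod>i<n. \<alpha> i * \<beta> (p i) * G i (p i))"
    using pr by (intro prod.cong) auto
  also have "\<dots> = (\<Prod>i<n. \<alpha> i) * (\<Prod>c<n. \<beta> c) * (\<Prod>i<n. G i (p i))"
    using prod.permute[OF p, of \<beta>] by (simp add: prod.distrib o_def)
  also have "(\<Prod>i<n. G i (p i)) = (\<Prod>i = 0..<n. mat n n (\<lambda>(i, c). G i c) $$ (i, p i))"
    using pr by (intro prod.cong) auto
  finally show "signof p * (\<Prod>i = 0..<n. mat n n (\<lambda>(i, c). \<alpha> i * \<beta> c * G i c) $$ (i, p i))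
      = (\<Prod>i<n. \<alpha> i) * (\<Prod>c<n. \<beta> c)
        * (signof p * (\<Prod>i = 0..<n. mat n n (\<lambda>(i, c). G i c) $$ (i, p i)))"
    by (simp only: mult_ac)
qed

lemma det_upper_triangular_prod:
  assumes "\<And>i c. c < i \<Longrightarrow> i < n \<Longrightarrow> G i c = 0"
  shows "det (mat n n (\<lambda>(i, c). G i c)) = (\<Prod>i<n. G i i)"
proof -
  let ?A = "mat n n (\<lambda>(i, c). G i c)"
  have "det ?A = prod_list (diag_mat ?A)"
    using assms by (intro det_upper_triangular[of _ n]) (auto simp: upper_triangular_def)
  also have "diag_mat ?A = map (\<lambda>i. G i i) [0..<n]"
    unfolding diag_mat_def by (intro map_cong) auto
  also have "prod_list \<dots> = (\<Prod>i\<in>set [0..<n]. G i i)"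
    by (rule prod.distinct_set_conv_list[symmetric]) simp
  finally show ?thesis by (simp add: atLeast0LessThan)
qed

lemma det_mult_mat:
  fixes A B :: "nat \<Rightarrow> nat \<Rightarrow> 'a :: comm_ring_1"
  shows "det (mat n n (\<lambda>(i, c). \<Sum>s<n. A i s * B s c)) =
    det (mat n n (\<lambda>(i, c). A i c)) * det (mat n n (\<lambda>(i, c). B i c))"
proof -
  have "mat n n (\<lambda>(i, c). \<Sum>s<n. A i s * B s c) = mat n n (\<lambda>(i, c). A i c) * mat n n (\<lambda>(i, c). B i c)"
    by (rule eq_matI) (auto simp: scalar_prod_def atLeast0LessThan)
  then show ?thesis by (simp add: det_mult[of _ n])
qed

text \<open>The matrix is a Vandermonde matrix times the coefficient matrix of the columns. By the
  binomial theorem, shifting the nodes multiplies the Vandermonde matrix by a unitriangular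
  one.\<close>

lemma det_poly_values_shift:
  fixes f :: "nat \<Rightarrow> 'a :: comm_ring_1 poly"
  assumes "\<And>l. l < b \<Longrightarrow> degree (f l) < b"
  shows "det (mat b b (\<lambda>(p, l). poly (f l) (of_nat p + c))) = det (mat b b (\<lambda>(p, l). poly (f l) (of_nat p)))"
proof -
  have poly_f: "poly (f l) y = (\<Sum>t<b. y ^ t * coeff (f l) t)" if "l < b" for l y
    unfolding poly_altdef using assms[OF that]
    by (intro sum.mono_neutral_cong_left) (auto simp: coeff_eq_0)
  have V: "det (mat b b (\<lambda>(p, l). poly (f l) (of_nat p + y))) =
      det (mat b b (\<lambda>(p, t). (of_nat p + y) ^ t)) * det (mat b b (\<lambda>(t, l). coeff (f l) t))" for y
    unfolding det_mult_mat[symmetric]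
    by (intro arg_cong[of _ _ det] cong_mat) (auto simp: poly_f)
  have "det (mat b b (\<lambda>(p, t). (of_nat p + c) ^ t)) =
      det (mat b b (\<lambda>(p, t). \<Sum>s<b. of_nat p ^ s * (if s \<le> t then of_nat (t choose s) * c ^ (t - s) else 0)))"
  proof (intro arg_cong[of _ _ det] cong_mat refl)
    fix p t assume "p < b" "t < b"
    then have "(of_nat p + c) ^ t = (\<Sum>s<b. of_nat p ^ s * (if s \<le> t then of_nat (t choose s) * c ^ (t - s) else 0))"
      unfolding binomial_ring
      by (intro sum.mono_neutral_cong_left) (auto simp: mult_ac)
    then show "(case (p, t) of (p, t) \<Rightarrow> (of_nat p + c) ^ t) = (case (p, t) of (p, t) \<Rightarrow>
        \<Sum>s<b. of_nat p ^ s * (if s \<le> t then of_nat (t choose s) * c ^ (t - s) else 0))" by simp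
  qed
  also have "\<dots> = det (mat b b (\<lambda>(p, t). of_nat p ^ t))"
    unfolding det_mult_mat by (subst (2) det_upper_triangular_prod) auto
  finally show ?thesis using V[of c] V[of 0] by simp
qed

lemma prod_falling: "l \<le> N \<Longrightarrow> (\<Prod>e<l. real N - real e) = fact N / fact (N - l)"
proof (induction l)
  case (Suc l)
  then have "(\<Prod>e<Suc l. real N - real e) = fact N / fact (N - l) * real (N - l)"
    by (simp add: of_nat_diff)
  also have "N - l = Suc (N - Suc l)" using Suc.prems by simp
  finally show ?case by (simp del: of_nat_Suc)
qed simp

lemma prod_rising: "(\<Prod>e=l+1..<l+1+d. real u + real e - real l) = fact (u + d) / fact u"
proof (induction d)
  case (Suc d)
  have "{l+1..<l+1+Suc d} = insert (l+1+d) {l+1..<l+1+d}" by auto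
  then have "(\<Prod>e=l+1..<l+1+Suc d. real u + real e - real l)
      = (real u + real (l + 1 + d) - real l) * (\<Prod>e=l+1..<l+1+d. real u + real e - real l)"
    by (simp only: prod.insert finite_atLeastLessThan atLeastLessThan_iff simp_thms less_irrefl)
  also have "\<dots> = real (Suc (u + d)) * (fact (u + d) / fact u)"
    unfolding Suc by simp
  also have "\<dots> = fact (u + Suc d) / fact u"
    by (simp only: add_Suc_right fact_Suc times_divide_eq_right)
  finally show ?case .
qed simp

text \<open>The column shape of Krattenthaler's determinant lemma: one family of linear factors for
  e > l, another for e < l, and total degree b - 1 in every column l < b. The parameter J stands for
  j - k.\<close>

definition krattenthaler_poly :: "nat \<Rightarrow> nat \<Rightarrow> nat \<Rightarrow> nat \<Rightarrow> real poly" where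
  "krattenthaler_poly b k J l = (\<Prod>e\<in>{l+1..<b}. [:real k + real e, -1:]) * (\<Prod>e<l. [:real J - real e, 2:])"

lemma degree_krattenthaler_poly:
  assumes "l < b"
  shows "degree (krattenthaler_poly b k J l) < b"
proof -
  have "degree (\<Prod>e\<in>{l+1..<b}. [:real k + real e, -1:]) \<le> b - (l + 1)"
    using degree_prod_sum_le[of "{l+1..<b}" "\<lambda>e. [:real k + real e, -1:]"] by (simp add: o_def)
  moreover have "degree (\<Prod>e<l. [:real J - real e, 2:]) \<le> l"
    using degree_prod_sum_le[of "{..<l}" "\<lambda>e. [:real J - real e, 2:]"] by (simp add: o_def)
  ultimately have "degree (krattenthaler_poly b k J l) \<le> b - (l + 1) + l"
    unfolding krattenthaler_poly_def by (meson degree_mult_le add_mono order.trans)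
  then show ?thesis using assms by simp
qed

lemma poly_krattenthaler_poly:
  "poly (krattenthaler_poly b k J l) y = (\<Prod>e\<in>{l+1..<b}. real k + real e - y) * (\<Prod>e<l. real J + 2 * y - real e)"
  by (simp add: krattenthaler_poly_def poly_prod algebra_simps)

text \<open>
  Replacing p by p + k does not change the determinant and makes the matrix triangular.
\<close>

lemma det_krattenthaler_poly:
  "det (mat b b (\<lambda>(p, l). poly (krattenthaler_poly b k J l) (real p)))
    = (\<Prod>l<b. fact (b - 1 - l) * fact (J + 2 * k + 2 * l) / fact (J + 2 * k + l))"
proof -
  have "det (mat b b (\<lambda>(p, l). poly (krattenthaler_poly b k J l) (real p)))
      = det (mat b b (\<lambda>(p, l). poly (krattenthaler_poly b k J l) (real p + real k)))"
    using det_poly_values_shift[of b "krattenthaler_poly b k J" "real k"] degree_krattenthaler_poly by simp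
  also have "\<dots> = (\<Prod>l<b. poly (krattenthaler_poly b k J l) (real l + real k))"
  proof (rule det_upper_triangular_prod)
    fix p l assume "l < p" "p < b"
    then have "(\<Prod>e\<in>{l+1..<b}. real k + real e - (real p + real k)) = 0"
      by (intro prod_zero) auto
    then show "poly (krattenthaler_poly b k J l) (real p + real k) = 0" by (simp add: poly_krattenthaler_poly)
  qed
  also have "\<dots> = (\<Prod>l<b. fact (b - 1 - l) * fact (J + 2 * k + 2 * l) / fact (J + 2 * k + l))"
  proof (intro prod.cong refl)
    fix l assume "l \<in> {..<b}"
    then have b: "b = l + 1 + (b - 1 - l)" by simp
    have "(\<Prod>e\<in>{l+1..<b}. real k + real e - (real l + real k)) = (\<Prod>e\<in>{l+1..<l+1+(b-1-l)}. real 0 + real e - real l)"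
      using b by (intro prod.cong) auto
    also have "\<dots> = fact (b - 1 - l)" by (subst prod_rising) simp
    finally have 1: "(\<Prod>e\<in>{l+1..<b}. real k + real e - (real l + real k)) = fact (b - 1 - l)" .
    have "(\<Prod>e<l. real J + 2 * (real l + real k) - real e) = (\<Prod>e<l. real (J + 2 * k + 2 * l) - real e)"
      by (simp add: algebra_simps)
    also have "\<dots> = fact (J + 2 * k + 2 * l) / fact (J + 2 * k + l)"
      by (subst prod_falling) (simp_all add: ac_simps)
    finally show "poly (krattenthaler_poly b k J l) (real l + real k) =
        fact (b - 1 - l) * fact (J + 2 * k + 2 * l) / fact (J + 2 * k + l)"
      unfolding poly_krattenthaler_poly 1 by simp
  qed
  finally show ?thesis .
qed

lemma bump_entry_0_eq_0: "n \<le> i \<or> 2 * i + 2 < n \<Longrightarrow> bump_entry i n 0 = 0"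
  unfolding bump_entry_def by (auto simp: binomial_eq_0 simp flip: binomial_gbinomial)

text \<open>With s = 2 i + 2 - n and u = i + 1 - s the entry is i! (2 u + s) / (2 s! u!), and 2 u +
  s = n depends on the column alone. Row factors turn 1/u! and 1/s! into the two products of linear
  factors in p.\<close>

lemma bump_entry_0_factor:
  assumes "p < b" "l < b" "k \<le> j" "1 \<le> j"
  shows "bump_entry (j - 1 + p) (j + k + l) 0 =
    (fact (j + p - 1) / 2 / (fact (k + b - 1 - p) * fact (j - k + 2 * p))) * real (j + k + l)
      * poly (krattenthaler_poly b k (j - k) l) (real p)"
proof -
  define i where "i = j - 1 + p"
  have i: "j + p - 1 = i" "j + p = Suc i" using assms by (auto simp: i_def)
  show ?thesis
  proof (cases "p \<le> k + l \<and> l \<le> j - k + 2 * p")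
    case False
    \<comment> \<open>Where u or s would be negative, one linear factor vanishes: the one with e = p
      - k, respectively e = j - k + 2 p.\<close>
    have "poly (krattenthaler_poly b k (j - k) l) (real p) = 0"
    proof (cases "p \<le> k + l")
      case True
      then have "(\<Prod>e<l. real (j - k) + 2 * real p - real e) = 0"
        using False by (intro prod_zero bexI[of _ "j - k + 2 * p"]) auto
      then show ?thesis by (simp add: poly_krattenthaler_poly)
    next
      case p: False
      then have "(\<Prod>e\<in>{l+1..<b}. real k + real e - real p) = 0"
        using assms by (intro prod_zero bexI[of _ "p - k"]) (auto simp: of_nat_diff)
      then show ?thesis by (simp add: poly_krattenthaler_poly)
    qed
    moreover have "bump_entry i (j + k + l) 0 = 0"
      using False assms by (intro bump_entry_0_eq_0) (auto simp: i_def)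
    ultimately show ?thesis by (simp add: i_def)
  next
    case True
    define u s where "u = k + l - p" and "s = j - k + 2 * p - l"
    have us: "u + s = Suc i" using True assms by (auto simp: u_def s_def i_def)
    have n: "2 * i + 2 - (j + k + l) = s" "j + k + l \<le> 2 * i + 2" "2 * i + 1 - (j + k + l) = s - 1"
      "j + k + l \<le> 2 * i + 1 \<longleftrightarrow> s \<noteq> 0"
      using True assms by (auto simp: i_def s_def)
    have 1: "real (i choose s) = fact i * real u / (fact s * fact u)"
    proof (cases u)
      case 0
      then show ?thesis using us by simp
    next
      case (Suc u')
      then have "i = s + u'" using us by simp
      then show ?thesis using Suc by (simp add: binomial_fact field_simps del: of_nat_Suc)
    qed
    have 2: "(if s \<noteq> 0 then real (i choose (s - 1)) else 0) = fact i * real s / (fact s * fact u)"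
    proof (cases s)
      case (Suc s')
      then have "i = s' + u" using us by simp
      then show ?thesis using Suc by (simp add: binomial_fact field_simps del: of_nat_Suc)
    qed simp
    have "bump_entry i (j + k + l) 0 = real (i choose s) + (if s \<noteq> 0 then real (i choose (s - 1)) else 0) / 2"
      using n(2) unfolding bump_entry_def n(1,3,4) by (simp add: binomial_gbinomial)
    also have "\<dots> = fact i * (2 * real u + real s) / (2 * (fact s * fact u))"
      unfolding 1 2 by (simp add: field_simps)
    also have "2 * real u + real s = real (j + k + l)"
    proof -
      have "2 * u + s = j + k + l" using True assms unfolding u_def s_def by linarith
      then show ?thesis by (metis of_nat_add of_nat_mult of_nat_numeral)
    qed
    finally have lhs: "bump_entry i (j + k + l) 0 = fact i * real (j + k + l) / (2 * (fact s * fact u))" .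
    have "(\<Prod>e\<in>{l+1..<b}. real k + real e - real p) = (\<Prod>e=l+1..<l+1+(b-1-l). real u + real e - real l)"
      using True assms by (intro prod.cong) (auto simp: u_def of_nat_diff)
    also have "\<dots> = fact (k + b - 1 - p) / fact u"
      using True assms by (subst prod_rising) (simp add: u_def)
    finally have a: "(\<Prod>e\<in>{l+1..<b}. real k + real e - real p) = fact (k + b - 1 - p) / fact u" .
    have "(\<Prod>e<l. real (j - k) + 2 * real p - real e) = (\<Prod>e<l. real (j - k + 2 * p) - real e)" by simp
    also have "\<dots> = fact (j - k + 2 * p) / fact s"
      using True by (subst prod_falling) (auto simp: s_def)
    finally have b: "(\<Prod>e<l. real (j - k) + 2 * real p - real e) = fact (j - k + 2 * p) / fact s" .
    show ?thesis unfolding i i_def[symmetric] lhs poly_krattenthaler_poly a b by (simp add: field_simps)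
  qed
qed

text \<open>
  The l-th (from 0) of the triangles on the northeast side that are not removed.
\<close>

definition dent_col :: "nat \<Rightarrow> nat \<Rightarrow> nat \<Rightarrow> nat" where
  "dent_col j k l = (if l + 1 < j then l + 1 else l + 1 + k)"

text \<open>The first j - 1 columns have n = l + 1 and vanish below the diagonal, where only the
  half-weighted binomial coefficient survives and equals 1/2. The other b rows and columns form the
  block with entries as in \<open>bump_entry_0_factor\<close>.\<close>

lemma det_bump_entry_0:
  assumes "1 \<le> j" "k \<le> j"
  shows "det (mat (j - 1 + b) (j - 1 + b) (\<lambda>(i, l). bump_entry i (dent_col j k l) 0)) =
    1 / 2 ^ (j - 1 + b) * (\<Prod>p<b. fact (j + p - 1) * real (j + k + p) * fact p * fact (j + k + 2 * p)
      / (fact (k + p) * fact (j - k + 2 * p) * fact (j + k + p)))"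
proof -
  let ?f = "\<lambda>i l. bump_entry i (dent_col j k l) 0"
  let ?m = "j - 1"
  note zero = bump_entry_0_eq_0
  have diag: "bump_entry i (Suc i) 0 = 1 / 2" for i
    unfolding bump_entry_def by (auto simp flip: binomial_gbinomial)
  have "mat (?m + b) (?m + b) (\<lambda>(i, l). ?f i l) = four_block_mat (mat ?m ?m (\<lambda>(i, l). ?f i l))
      (mat ?m b (\<lambda>(i, l). ?f i (?m + l))) (0\<^sub>m b ?m) (mat b b (\<lambda>(p, l). ?f (?m + p) (?m + l)))"
    by (rule eq_matI) (auto simp: zero dent_col_def)
  then have "det (mat (?m + b) (?m + b) (\<lambda>(i, l). ?f i l)) =
      det (mat ?m ?m (\<lambda>(i, l). ?f i l)) * det (mat b b (\<lambda>(p, l). ?f (?m + p) (?m + l)))"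
    by (simp add: det_four_block_mat_lower_left_zero[of _ ?m _ b])
  also have "det (mat ?m ?m (\<lambda>(i, l). ?f i l)) = (\<Prod>i<?m. ?f i i)"
    by (rule det_upper_triangular_prod) (auto simp: zero dent_col_def)
  also have "\<dots> = (\<Prod>i<?m. 1 / 2)"
    by (intro prod.cong) (auto simp: dent_col_def diag)
  also have "\<dots> = (1 / 2) ^ ?m" by simp
  also have "det (mat b b (\<lambda>(p, l). ?f (?m + p) (?m + l))) =
      det (mat b b (\<lambda>(p, l). (fact (j + p - 1) / 2 / (fact (k + b - 1 - p) * fact (j - k + 2 * p)))
        * real (j + k + l) * poly (krattenthaler_poly b k (j - k) l) (real p)))"
  proof (intro arg_cong[of _ _ det] cong_mat refl)
    fix p l assume pl: "p < b" "l < b"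
    have "dent_col j k (?m + l) = j + k + l" using assms by (auto simp: dent_col_def)
    then show "(case (p, l) of (p, l) \<Rightarrow> ?f (?m + p) (?m + l)) = (case (p, l) of (p, l) \<Rightarrow>
        (fact (j + p - 1) / 2 / (fact (k + b - 1 - p) * fact (j - k + 2 * p)))
        * real (j + k + l) * poly (krattenthaler_poly b k (j - k) l) (real p))"
      using bump_entry_0_factor[OF pl assms(2,1)] by simp
  qed
  also have "\<dots> = (\<Prod>p<b. fact (j + p - 1) / 2 / (fact (k + b - 1 - p) * fact (j - k + 2 * p)))
      * (\<Prod>p<b. real (j + k + p)) * (\<Prod>l<b. fact (b - 1 - l) * fact (j + k + 2 * l) / fact (j + k + l))"
  proof -
    have e: "j - k + 2 * k = j + k" using assms(2) by simp
    show ?thesis unfolding det_scale_rows_cols det_krattenthaler_poly e by (rule refl)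
  qed
  also have "\<dots> = (\<Prod>p<b. fact (j + p - 1) / 2 / fact (j - k + 2 * p)) / (\<Prod>p<b. fact (k + (b - 1 - p)))
      * (\<Prod>p<b. real (j + k + p)) * ((\<Prod>l<b. fact (b - 1 - l)) * (\<Prod>l<b. fact (j + k + 2 * l) / fact (j + k + l)))"
  proof -
    have "(\<Prod>p<b. fact (j + p - 1) / 2 / (fact (k + b - 1 - p) * fact (j - k + 2 * p)))
      = (\<Prod>p<b. fact (j + p - 1) / 2 / fact (j - k + 2 * p) / (fact (k + (b - 1 - p)) :: real))"
      by (intro prod.cong) (auto simp: field_simps)
    then show ?thesis by (simp add: prod_dividef prod.distrib)
  qed
  also have "(\<Prod>p<b. fact (k + (b - 1 - p))) = (\<Prod>p<b. fact (k + p) :: real)"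
    using prod.nat_diff_reindex[of "\<lambda>p. fact (k + p) :: real" b] by simp
  also have "(\<Prod>p<b. fact (b - 1 - p)) = (\<Prod>p<b. fact p :: real)"
    using prod.nat_diff_reindex[of "\<lambda>p. fact p :: real" b] by simp
  also have "(\<Prod>p<b. fact (j + p - 1) / 2 / fact (j - k + 2 * p)) / (\<Prod>p<b. fact (k + p))
      * (\<Prod>p<b. real (j + k + p)) * ((\<Prod>p<b. fact p) * (\<Prod>l<b. fact (j + k + 2 * l) / fact (j + k + l)))
    = (\<Prod>p<b. fact (j + p - 1) / 2 / fact (j - k + 2 * p) / fact (k + p)
      * real (j + k + p) * (fact p * (fact (j + k + 2 * p) / fact (j + k + p))))"
    by (simp only: prod_dividef prod.distrib)
  also have "\<dots> = (\<Prod>p<b. 1 / 2 * (fact (j + p - 1) * real (j + k + p) * fact p * fact (j + k + 2 * p)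
      / (fact (k + p) * fact (j - k + 2 * p) * fact (j + k + p))))"
    by (intro prod.cong refl) (simp add: field_simps)
  also have "\<dots> = (1 / 2) ^ b * (\<Prod>p<b. fact (j + p - 1) * real (j + k + p) * fact p * fact (j + k + 2 * p)
      / (fact (k + p) * fact (j - k + 2 * p) * fact (j + k + p)))"
    by (simp only: prod.distrib prod_constant card_lessThan)
  finally show ?thesis
    by (simp only: power_add power_one_over mult.assoc times_divide_times_eq mult_1_left mult_1_right
        divide_divide_eq_left times_divide_eq_left times_divide_eq_right)
qed

section \<open>Roots and degree\<close>

definition gbinomial_poly :: "real \<Rightarrow> nat \<Rightarrow> real poly" where
  "gbinomial_poly c s = smult (inverse (fact s)) (\<Prod>t<s. [:c - real t, 1:])"

lemma poly_gbinomial_poly [simp]: "poly (gbinomial_poly c s) y = (y + c) gchoose s"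
  by (simp add: gbinomial_poly_def poly_prod gbinomial_prod_rev atLeast0LessThan
      divide_inverse algebra_simps)

lemma degree_gbinomial_poly: "degree (gbinomial_poly c s) \<le> s"
proof -
  have "degree (\<Prod>t<s. [:c - real t, 1:]) \<le> (\<Sum>t<s. degree [:c - real t, 1:])"
    using degree_prod_sum_le[of "{..<s}" "\<lambda>t. [:c - real t, 1:]"] by (simp add: o_def)
  then show ?thesis
    unfolding gbinomial_poly_def by (intro order.trans[OF degree_smult_le]) simp
qed

definition bump_poly :: "nat \<Rightarrow> nat \<Rightarrow> real poly" where
  "bump_poly i n = (if n \<le> 2 * i + 2 then gbinomial_poly (real i) (2 * i + 2 - n) else 0)
     + (if n \<le> 2 * i + 1 then smult (1 / 2) (gbinomial_poly (real i) (2 * i + 1 - n)) else 0)"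

definition half_poly :: "nat \<Rightarrow> nat \<Rightarrow> real poly" where
  "half_poly i n = (if n \<le> 2 * i + 2 then gbinomial_poly (real i + 1 / 2) (2 * i + 2 - n) else 0)"

lemma poly_bump_poly: "poly (bump_poly i n) y = bump_entry i n y"
  by (simp add: bump_poly_def bump_entry_def)

lemma poly_half_poly: "poly (half_poly i n) y = half_entry i n y"
  by (simp add: half_poly_def half_entry_def add.assoc)

lemma poly_det:
  "poly (det (mat r r (\<lambda>(i, l). f i l))) y = det (mat r r (\<lambda>(i, l). poly (f i l) y))"
  unfolding det_def'[OF mat_carrier] poly_sum
proof (intro sum.cong refl)
  fix p assume "p \<in> {p. p permutes {0..<r}}"
  then have "p i < r" if "i < r" for i
    using permutes_in_image[of p "{0..<r}" i] that by simp
  then show "poly (signof p * (\<Prod>i = 0..<r. mat r r (\<lambda>(i, l). f i l) $$ (i, p i))) y =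
      signof p * (\<Prod>i = 0..<r. mat r r (\<lambda>(i, l). poly (f i l) y) $$ (i, p i))"
    by (cases p rule: sign_cases) (simp_all add: poly_prod)
qed

text \<open>
  If the rows in I are divisible by q outside the columns in C, then every term of the Leibniz
  formula contains at least card I - card C factors divisible by q.
\<close>

lemma power_dvd_det:
  fixes A :: "'a :: comm_ring_1 mat"
  assumes A: "A \<in> carrier_mat n n" and I: "I \<subseteq> {0..<n}" and "finite C"
    and dvd: "\<And>i c. i \<in> I \<Longrightarrow> c < n \<Longrightarrow> c \<notin> C \<Longrightarrow> q dvd A $$ (i, c)"
  shows "q ^ (card I - card C) dvd det A"
  unfolding det_def'[OF A]
proof (intro dvd_sum dvd_mult)
  fix p assume "p \<in> {p. p permutes {0..<n}}"
  then have p: "p permutes {0..<n}" by simp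
  have "finite I" using I finite_subset by blast
  let ?J = "{i \<in> I. p i \<notin> C}"
  have "card I = card ?J + card {i \<in> I. p i \<in> C}"
    using \<open>finite I\<close> by (subst card_Un_disjoint[symmetric]) (auto intro: arg_cong[of _ _ card])
  moreover have "card {i \<in> I. p i \<in> C} \<le> card C"
    using \<open>finite C\<close> permutes_inj_on[OF p]
    by (intro card_inj_on_le[of p]) (auto intro: inj_on_subset)
  ultimately have "q ^ (card I - card C) dvd q ^ card ?J" by (intro le_imp_power_dvd) simp
  also have "\<dots> = (\<Prod>i\<in>?J. q)" by simp
  also have "\<dots> dvd (\<Prod>i\<in>?J. A $$ (i, p i))"
  proof (rule prod_dvd_prod)
    fix i assume i: "i \<in> ?J"
    then have "p i < n" using I permutes_in_image[OF p, of i] by auto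
    then show "q dvd A $$ (i, p i)" using i dvd by simp
  qed
  also have "\<dots> dvd (\<Prod>i = 0..<n. A $$ (i, p i))"
    using I by (intro prod_dvd_prod_subset) auto
  finally show "q ^ (card I - card C) dvd (\<Prod>i = 0..<n. A $$ (i, p i))" .
qed

text \<open>Powers of distinct linear factors are coprime: the product already split off has order 0
  at the next root, so the cofactor carries the whole order.\<close>

lemma prod_linear_powers_dvd:
  fixes g :: "'a :: idom poly" and \<xi> :: "'b \<Rightarrow> 'a"
  assumes "finite S" "inj_on \<xi> S" "\<And>s. s \<in> S \<Longrightarrow> [:\<xi> s, 1:] ^ m s dvd g"
  shows "(\<Prod>s\<in>S. [:\<xi> s, 1:] ^ m s) dvd g"
  using assms
proof (induction S rule: finite_induct)
  case (insert s S)
  let ?Q = "\<Prod>s\<in>S. [:\<xi> s, 1:] ^ m s"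
  obtain h where h: "g = ?Q * h" using insert by (auto elim: dvdE)
  have "poly ?Q (- \<xi> s) \<noteq> 0"
    using insert by (auto simp: poly_prod poly_power inj_on_def)
  then have "?Q \<noteq> 0" "order (- \<xi> s) ?Q = 0" by (auto simp: order_0I simp del: prod_zero_iff)
  moreover have "[:\<xi> s, 1:] ^ m s dvd g" using insert by simp
  ultimately have "[:\<xi> s, 1:] ^ m s dvd h"
    using order_divides[of "- \<xi> s" "m s" g] order_divides[of "- \<xi> s" "m s" h]
      order_mult[of ?Q h "- \<xi> s"] h by (cases "g = 0") auto
  then show ?case using insert(1,2) h by (simp add: mult_dvd_mono mult.commute)
qed simp

definition det_poly :: "nat \<Rightarrow> (nat \<Rightarrow> nat) \<Rightarrow> real poly" where
  "det_poly r \<nu> = det (mat r r (\<lambda>(i, l). half_poly i (\<nu> l)))"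

lemma det_poly_eq_bump:
  assumes "\<And>l. l < r \<Longrightarrow> \<nu> l \<ge> 1"
  shows "det_poly r \<nu> = det (mat r r (\<lambda>(i, l). bump_poly i (\<nu> l)))"
proof -
  have "poly (det_poly r \<nu>) y = poly (det (mat r r (\<lambda>(i, l). bump_poly i (\<nu> l)))) y" for y
    unfolding det_poly_def poly_det poly_half_poly poly_bump_poly
    by (rule det_bump_half[OF assms, symmetric])
  then show ?thesis by (subst poly_eq_poly_eq_iff[symmetric]) auto
qed

lemma poly_det_poly:
  assumes "\<And>l. l < r \<Longrightarrow> \<nu> l \<ge> 1"
  shows "poly (det_poly r \<nu>) y = det (mat r r (\<lambda>(i, l). bump_entry i (\<nu> l) y))"
proof -
  have "det_poly r \<nu> = det (mat r r (\<lambda>(i, l). bump_poly i (\<nu> l)))"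
    using assms by (rule det_poly_eq_bump)
  then show ?thesis by (simp only: poly_det poly_bump_poly)
qed

lemma gbinomial_nat_eq_0: "N < s \<Longrightarrow> (real N gchoose s) = 0"
  by (simp flip: binomial_gbinomial)

text \<open>In the form chosen by the parity of s, the upper argument at -s/2 is i - s div 2. For i
  >= s div 2 it is a natural number smaller than the lower argument in every column with \<nu> <= s,
  so these rows vanish outside the columns beyond s.\<close>

lemma linear_power_dvd_det_poly:
  assumes "\<And>l. l < r \<Longrightarrow> \<nu> l \<ge> 1"
  shows "[:real s / 2, 1:] ^ (r - s div 2 - card {l. l < r \<and> s < \<nu> l}) dvd det_poly r \<nu>"
proof -
  have dvd: "[:real s / 2, 1:] dvd f \<longleftrightarrow> poly f (- (real s / 2)) = 0" for f
    using poly_eq_0_iff_dvd[of f "- (real s / 2)"] by simp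
  have card: "r - s div 2 = card {s div 2..<r}" by simp
  show ?thesis
  proof (cases "even s")
    case True
    then obtain m where s: "s = 2 * m" by auto
    have "det_poly r \<nu> = det (mat r r (\<lambda>(i, l). bump_poly i (\<nu> l)))"
      using assms by (rule det_poly_eq_bump)
    then show ?thesis unfolding card
    proof (elim ssubst, intro power_dvd_det[of _ r])
      fix i c assume i: "i \<in> {s div 2..<r}" and c: "c < r" "c \<notin> {l. l < r \<and> s < \<nu> l}"
      then have "\<nu> c \<le> 2 * m" "m \<le> i" using s by auto
      then have "bump_entry i (\<nu> c) (- real m) = 0"
        using gbinomial_nat_eq_0[of "i - m"] by (auto simp: bump_entry_def of_nat_diff)
      then show "[:real s / 2, 1:] dvd mat r r (\<lambda>(i, l). bump_poly i (\<nu> l)) $$ (i, c)"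
        using i c s dvd[of "bump_poly i (\<nu> c)"] by (simp add: poly_bump_poly)
    qed auto
  next
    case False
    then obtain m where s: "s = 2 * m + 1" by (elim oddE)
    show ?thesis unfolding det_poly_def card
    proof (rule power_dvd_det[of _ r])
      fix i c assume i: "i \<in> {s div 2..<r}" and c: "c < r" "c \<notin> {l. l < r \<and> s < \<nu> l}"
      then have "\<nu> c \<le> 2 * m + 1" "m \<le> i" using s by auto
      have e: "- (real s / 2) + real i + 1 / 2 = real (i - m)"
        using \<open>m \<le> i\<close> s by (simp add: of_nat_diff field_simps)
      have "half_entry i (\<nu> c) (- (real s / 2)) = 0"
        unfolding half_entry_def e
        using gbinomial_nat_eq_0[of "i - m" "2 * i + 2 - \<nu> c"] \<open>\<nu> c \<le> 2 * m + 1\<close> \<open>m \<le> i\<close> by simp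
      then show "[:real s / 2, 1:] dvd mat r r (\<lambda>(i, l). half_poly i (\<nu> l)) $$ (i, c)"
        using i c dvd[of "half_poly i (\<nu> c)"] by (simp add: poly_half_poly)
    qed auto
  qed
qed

text \<open>The bounds 2 i + 2 - \<nu> add up to the same number in every Leibniz term. A term in
  which some difference would be negative is 0, so truncated subtraction does no harm.\<close>

lemma degree_det_poly: "degree (det_poly r \<nu>) \<le> (\<Sum>i<r. 2 * i + 2) - (\<Sum>l<r. \<nu> l)"
  unfolding det_poly_def det_def'[OF mat_carrier]
proof (intro degree_sum_le)
  fix p assume "p \<in> {p. p permutes {0..<r}}"
  then have p: "p permutes {..<r}" by (simp add: atLeast0LessThan)
  then have pr: "p i < r" if "i < r" for i
    using permutes_in_image[of p "{..<r}" i] that by simp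
  have eq: "(\<Prod>i = 0..<r. mat r r (\<lambda>(i, l). half_poly i (\<nu> l)) $$ (i, p i)) = (\<Prod>i<r. half_poly i (\<nu> (p i)))"
    using pr by (intro prod.cong) auto
  have sgn: "degree (signof p * f) \<le> degree f" for f :: "real poly"
    by (cases p rule: sign_cases) simp_all
  show "degree (signof p * (\<Prod>i = 0..<r. mat r r (\<lambda>(i, l). half_poly i (\<nu> l)) $$ (i, p i)))
      \<le> (\<Sum>i<r. 2 * i + 2) - (\<Sum>l<r. \<nu> l)"
  proof (cases "\<forall>i<r. \<nu> (p i) \<le> 2 * i + 2")
    case True
    have "degree (\<Prod>i<r. half_poly i (\<nu> (p i))) \<le> (\<Sum>i<r. degree (half_poly i (\<nu> (p i))))"
      using degree_prod_sum_le[of "{..<r}" "\<lambda>i. half_poly i (\<nu> (p i))"] by (simp add: o_def)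
    also have "\<dots> \<le> (\<Sum>i<r. 2 * i + 2 - \<nu> (p i))"
      by (intro sum_mono) (auto simp: half_poly_def degree_gbinomial_poly)
    also have "\<dots> = (\<Sum>i<r. 2 * i + 2) - (\<Sum>i<r. \<nu> (p i))"
      using True by (intro sum_subtractf_nat) auto
    also have "(\<Sum>i<r. \<nu> (p i)) = (\<Sum>l<r. \<nu> l)"
      using sum.permute[OF p, of \<nu>] by (simp add: o_def)
    finally show ?thesis unfolding eq by (rule order.trans[OF sgn])
  next
    case False
    then have z: "(\<Prod>i<r. half_poly i (\<nu> (p i))) = 0" by (auto simp: half_poly_def)
    show ?thesis unfolding eq z by simp
  qed
qed (simp add: finite_permutations)

section \<open>The weighted region as a determinant\<close>

lemma bump_weight_simps:
  "bump_weight a k {Up p q, Down p q} = 1"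
  "bump_weight a k {Up p q, Down (p - 1) q} = 1"
  "bump_weight a k {Up p q, Down p (q - 1)} =
     (if 2 * p + q = -1 \<and> 0 \<le> q \<and> q < 2 * int (a + k) then 1 / 2 else 1)"
proof -
  show "bump_weight a k {Up p q, Down p q} = 1" "bump_weight a k {Up p q, Down (p - 1) q} = 1"
    by (auto simp: bump_weight_def bump_lozenges_def vertical_lozenge_def doubleton_eq_iff)
  have "{Up p q, Down p (q - 1)} \<in> bump_lozenges a k \<longleftrightarrow>
      2 * p + q = -1 \<and> 0 \<le> q \<and> q < 2 * int (a + k)" (is "?l \<longleftrightarrow> ?r")
  proof
    assume ?r
    then have "{Up p q, Down p (q - 1)} = vertical_lozenge (- (int (nat (- p - 1)) + 1)) (2 * int (nat (- p - 1)) + 1)"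
      "nat (- p - 1) < a + k"
      by (auto simp: vertical_lozenge_def doubleton_eq_iff)
    then show ?l unfolding bump_lozenges_def by blast
  qed (auto simp: bump_lozenges_def vertical_lozenge_def doubleton_eq_iff)
  then show "bump_weight a k {Up p q, Down p (q - 1)} =
     (if 2 * p + q = -1 \<and> 0 \<le> q \<and> q < 2 * int (a + k) then 1 / 2 else 1)"
    by (simp add: bump_weight_def)
qed

text \<open>Here w + s = x + c + 1, so the special value at w = s = 0 does not occur; for w < 0 the
  lower arguments exceed x + c and the binomial coefficients vanish as well.\<close>

lemma path_gf_eq_bump_entry:
  "path_gf (int x + int n - 1 - int c) (2 * int c + 2 - int n) = bump_entry c n (real x)"
proof (cases "n \<le> 2 * c + 2")
  case True
  define s where "s = 2 * c + 2 - n"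
  have s: "2 * int c + 2 - int n = int s" "2 * c + 2 - n = s" "2 * c + 1 - n = s - 1"
    "n \<le> 2 * c + 1 \<longleftrightarrow> s \<noteq> 0"
    using True by (auto simp: s_def)
  have entry: "bump_entry c n (real x) =
      real (x + c choose s) + (if s = 0 then 0 else real (x + c choose (s - 1)) / 2)"
    unfolding bump_entry_def s(2-4) using True by (simp add: binomial_gbinomial)
  show ?thesis
  proof (cases "x + n < 1 + c")
    case True
    then have "x + c < s" "x + c < s - 1" using \<open>n \<le> 2 * c + 2\<close> by (auto simp: s_def)
    then show ?thesis using True unfolding entry by (auto simp: path_gf_def binomial_eq_0)
  next
    case False
    have "nat (int x + int n - 1 - int c + int s - 1) = x + c"
      using False True by (auto simp: s_def)
    moreover have "nat (int s) = s" "nat (int s - 1) = s - 1" by auto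
    moreover have "\<not> (int x + int n - 1 - int c = 0 \<and> int s = 0)"
      using False True by (auto simp: s_def)
    ultimately show ?thesis unfolding entry path_gf_def s(1) using False by auto
  qed
next
  case False
  then show ?thesis by (simp add: path_gf_def bump_entry_def)
qed

text \<open>The initial heads are the remaining triangles of the northeast side. They fill the last
  diagonal p + q + 1 = x + a + k of sites, and the down triangles at these points lie outside the
  region, as heads require.\<close>

lemma M_region_eq_det:
  assumes "1 \<le> j" "j \<le> a + k + 1"
  shows "M_region a k (int j) x =
    det (mat (a + k) (a + k) (\<lambda>(i, l). bump_entry i (dent_col j k l) (real x)))"
proof -
  let ?r = "a + k"
  let ?R = "region a k (int j) x"
  define V where "V = {(p, q). Up p q \<in> ?R}"
  define h where "h l = (int x - int ?r - 1 + int (dent_col j k l), 2 * int ?r - int (dent_col j k l))" for l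
  have V: "(p, q) \<in> V \<longleftrightarrow> 0 \<le> q \<and> q + 1 \<le> 2 * int ?r \<and> p + q + 1 \<le> int x + int ?r
      \<and> p + 1 \<le> int x + int k \<and> 2 * p + q \<ge> -1
      \<and> \<not> (p + q + 1 = int x + int ?r \<and> 2 * int ?r - int j - int k < q \<and> q \<le> 2 * int ?r - int j)" for p q
  proof -
    have "Up p q \<in> ne_triangle a k x ` {int j..int j + int k - 1} \<longleftrightarrow>
        p + q + 1 = int x + int ?r \<and> 2 * int ?r - int j - int k < q \<and> q \<le> 2 * int ?r - int j" (is "?l \<longleftrightarrow> ?r'")
    proof
      assume ?r'
      then have "Up p q = ne_triangle a k x (2 * int ?r - q)" "2 * int ?r - q \<in> {int j..int j + int k - 1}"
        by (auto simp: ne_triangle_def)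
      then show ?l by blast
    qed (auto simp: ne_triangle_def)
    then show ?thesis by (auto simp: V_def region_def Up_in_full_region)
  qed
  have h_V: "h l \<in> V" if "l < ?r" for l
    using that assms unfolding h_def V by (auto simp: dent_col_def)
  have h_iff: "(p, q) \<in> h ` {..<?r} \<longleftrightarrow> (p, q) \<in> V \<and> p + q + 1 = int x + int ?r" for p q
  proof
    assume pq: "(p, q) \<in> V \<and> p + q + 1 = int x + int ?r"
    define n where "n = nat (2 * int ?r - q)"
    have n: "q = 2 * int ?r - int n" "p = int x - int ?r - 1 + int n" "1 \<le> n" "n \<le> ?r + k"
      "n < j \<or> j + k \<le> n"
      using pq unfolding V n_def by auto
    define l where "l = (if n < j then n - 1 else n - 1 - k)"
    have "dent_col j k l = n" "l < ?r" using n assms by (auto simp: l_def dent_col_def)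
    then show "(p, q) \<in> h ` {..<?r}" using n unfolding h_def by (intro image_eqI[of _ _ l]) auto
  next
    assume "(p, q) \<in> h ` {..<?r}"
    then obtain l where "l < ?r" "(p, q) = h l" by auto
    then show "(p, q) \<in> V \<and> p + q + 1 = int x + int ?r" using h_V[of l] by (auto simp: h_def)
  qed
  have "?R = sites_region ?r V (h ` {..<?r})"
  proof (rule sites_region_eqI)
    fix p q
    have "Down p q \<in> ?R \<longleftrightarrow> Down p q \<in> full_region a k x"
      by (auto simp: region_def ne_triangle_def)
    then show "Down p q \<in> ?R \<longleftrightarrow> (p, q) \<in> V \<union> ends ?r \<and> (p, q) \<notin> h ` {..<?r}"
      unfolding h_iff Un_iff V mem_ends Down_in_full_region by auto
  qed (simp add: V_def)
  moreover have "finite V"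
  proof (rule finite_subset)
    show "V \<subseteq> {- int ?r..int x + int k} \<times> {0..2 * int ?r}" by (auto simp: V)
  qed simp
  ultimately have "M_region a k (int j) x =
      det (mat ?r ?r (\<lambda>(i, c). path_gf (fst (h i) + int (?r - c)) (snd (h i) - 2 * int (?r - 1 - c))))"
    unfolding M_region_def
  proof (elim ssubst, intro matching_gf_sites_region_det)
    show "snd (h i') < snd (h i)" if "i < i'" for i i'
      using that by (auto simp: h_def dent_col_def)
    show "p + q - 1 \<le> fst (h i) + snd (h i)" if "(p, q) \<in> V" for i p q
      using that by (auto simp: h_def V)
    show "h i \<in> V \<union> ends ?r" if "i < ?r" for i using h_V[OF that] by blast
  qed (auto simp: V mem_ends bump_weight_simps)
  \<comment> \<open>The path determinant has a row for each starting point; from here on, rows stand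
    for the ends, counted from the north.\<close>
  also have "mat ?r ?r (\<lambda>(i, c). path_gf (fst (h i) + int (?r - c)) (snd (h i) - 2 * int (?r - 1 - c)))
      = transpose_mat (mat ?r ?r (\<lambda>(i, l). bump_entry i (dent_col j k l) (real x)))"
  proof (rule eq_matI)
    fix l c assume "l < dim_row (transpose_mat (mat ?r ?r (\<lambda>(i, l). bump_entry i (dent_col j k l) (real x))))"
      "c < dim_col (transpose_mat (mat ?r ?r (\<lambda>(i, l). bump_entry i (dent_col j k l) (real x))))"
    then have lc: "l < ?r" "c < ?r" by auto
    have e: "fst (h l) + int (?r - c) = int x + int (dent_col j k l) - 1 - int c"
      "snd (h l) - 2 * int (?r - 1 - c) = 2 * int c + 2 - int (dent_col j k l)"
      using lc by (auto simp: h_def of_nat_diff)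
    show "mat ?r ?r (\<lambda>(i, c). path_gf (fst (h i) + int (?r - c)) (snd (h i) - 2 * int (?r - 1 - c))) $$ (l, c)
      = transpose_mat (mat ?r ?r (\<lambda>(i, l). bump_entry i (dent_col j k l) (real x))) $$ (l, c)"
      using lc by (simp only: index_mat case_prod_conv e path_gf_eq_bump_entry) simp
  qed auto
  finally show ?thesis by (simp add: det_transpose[of _ ?r])
qed

section \<open>Multiplicities of the roots\<close>

text \<open>The number of pairs \<open>n \<le> m \<le> N\<close> of positive integers with n + m - 1 = s.\<close>

definition spp_mult :: "nat \<Rightarrow> nat \<Rightarrow> nat" where
  "spp_mult N s = min ((s + 1) div 2) (N - s div 2)"

text \<open>The new pairs are (n, N + 1), for which n + N runs once through N + 1, ..., 2 N +
  1.\<close>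

lemma spp_mult_Suc: "spp_mult (Suc N) s = spp_mult N s + (if N + 1 \<le> s \<and> s \<le> 2 * N + 1 then 1 else 0)"
proof (cases "even s")
  case True
  then obtain m where "s = 2 * m" by auto
  then show ?thesis by (auto simp: spp_mult_def min_def)
next
  case False
  then obtain m where "s = 2 * m + 1" by (elim oddE)
  then show ?thesis by (auto simp: spp_mult_def min_def)
qed

lemma prod_spp_mult:
  fixes f :: "nat \<Rightarrow> 'a :: comm_semiring_1"
  assumes "2 * N \<le> U"
  shows "(\<Prod>s=1..U. f s ^ spp_mult N s) = (\<Prod>(n, m)\<in>{(n, m). 1 \<le> n \<and> n \<le> m \<and> m \<le> N}. f (n + m - 1))"
  using assms
proof (induction N)
  case 0
  have e: "{(n, m). 1 \<le> n \<and> n \<le> m \<and> m \<le> (0 :: nat)} = {}" by auto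
  show ?case unfolding e by (simp add: spp_mult_def)
next
  case (Suc N)
  let ?S = "\<lambda>N. {(n, m). 1 \<le> n \<and> n \<le> m \<and> m \<le> (N :: nat)}"
  have fin: "finite (?S N)"
    by (rule finite_subset[of _ "{..N} \<times> {..N}"]) auto
  have "(\<Prod>s=1..U. f s ^ spp_mult (Suc N) s)
      = (\<Prod>s=1..U. f s ^ spp_mult N s) * (\<Prod>s=1..U. if s \<in> {N+1..2*N+1} then f s else 1)"
    unfolding prod.distrib[symmetric]
    by (intro prod.cong) (auto simp: spp_mult_Suc power_add)
  also have "(\<Prod>s=1..U. if s \<in> {N+1..2*N+1} then f s else 1) = (\<Prod>s=N+1..2*N+1. f s)"
    using Suc.prems by (intro prod.mono_neutral_cong_right) auto
  also have "\<dots> = (\<Prod>n=1..Suc N. f (n + N))"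
    using prod.shift_bounds_cl_nat_ivl[of f 1 N "Suc N"] by (simp add: mult_2 add.commute)
  also have "\<dots> = (\<Prod>(n, m)\<in>(\<lambda>n. (n, Suc N)) ` {1..Suc N}. f (n + m - 1))"
    by (subst prod.reindex) (auto simp: inj_on_def)
  also have "(\<Prod>s=1..U. f s ^ spp_mult N s) * \<dots> = (\<Prod>(n, m)\<in>?S N \<union> (\<lambda>n. (n, Suc N)) ` {1..Suc N}. f (n + m - 1))"
    using Suc fin by (subst prod.union_disjoint) auto
  also have "?S N \<union> (\<lambda>n. (n, Suc N)) ` {1..Suc N} = ?S (Suc N)" by auto
  finally show ?case .
qed

lemma sum_spp_mult:
  assumes "2 * N \<le> U"
  shows "2 * (\<Sum>s=1..U. spp_mult N s) = N * (N + 1)"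
  using assms
proof (induction N)
  case (Suc N)
  have "(\<Sum>s=1..U. spp_mult (Suc N) s) = (\<Sum>s=1..U. spp_mult N s) + (\<Sum>s=1..U. if s \<in> {N+1..2*N+1} then 1 else 0)"
    unfolding sum.distrib[symmetric] by (intro sum.cong) (auto simp: spp_mult_Suc)
  also have "(\<Sum>s=1..U. if s \<in> {N+1..2*N+1} then 1 else (0::nat)) = (\<Sum>s=N+1..2*N+1. 1)"
    using Suc.prems by (intro sum.mono_neutral_cong_right) auto
  finally show ?case using Suc by simp
qed (simp add: spp_mult_def)

text \<open>Truncated subtraction sends every s <= 2 k to 0, where the multiplicity is 0, so only
  the last 2 a indices contribute.\<close>

lemma spp_mult_shift:
  fixes f :: "nat \<Rightarrow> 'a :: comm_semiring_1"
  shows "(\<Prod>s=1..2 * (a + k). f s ^ spp_mult N (s - 2 * k)) = (\<Prod>s=1..2 * a. f (s + 2 * k) ^ spp_mult N s)"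
    and "(\<Sum>s=1..2 * (a + k). spp_mult N (s - 2 * k)) = (\<Sum>s=1..2 * a. spp_mult N s)"
proof -
  have z: "spp_mult N 0 = 0" by (simp add: spp_mult_def)
  have "(\<Prod>s=1..2 * (a + k). f s ^ spp_mult N (s - 2 * k)) = (\<Prod>s=1 + 2 * k..2 * a + 2 * k. f s ^ spp_mult N (s - 2 * k))"
    using z by (intro prod.mono_neutral_right) auto
  then show "(\<Prod>s=1..2 * (a + k). f s ^ spp_mult N (s - 2 * k)) = (\<Prod>s=1..2 * a. f (s + 2 * k) ^ spp_mult N s)"
    unfolding prod.shift_bounds_cl_nat_ivl by simp
  have "(\<Sum>s=1..2 * (a + k). spp_mult N (s - 2 * k)) = (\<Sum>s=1 + 2 * k..2 * a + 2 * k. spp_mult N (s - 2 * k))"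
    using z by (intro sum.mono_neutral_right) auto
  then show "(\<Sum>s=1..2 * (a + k). spp_mult N (s - 2 * k)) = (\<Sum>s=1..2 * a. spp_mult N s)"
    unfolding sum.shift_bounds_cl_nat_ivl by simp
qed

text \<open>The order of vanishing at -s/2 that \<open>linear_power_dvd_det_poly\<close>
  guarantees.\<close>

definition root_mult :: "nat \<Rightarrow> nat \<Rightarrow> nat \<Rightarrow> nat \<Rightarrow> nat" where
  "root_mult r j k s = r - s div 2 - card {l. l < r \<and> s < dent_col j k l}"

lemma card_dent_col:
  assumes "1 \<le> j" "j \<le> r + 1"
  shows "card {l. l < r \<and> s < dent_col j k l} =
    (if s < j then r - s else if s < j + k then r + 1 - j else r + k - s)"
proof -
  have "{l. l < r \<and> s < dent_col j k l} =
      (if s < j then {s..<r} else if s < j + k then {j - 1..<r} else {s - k..<r})"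
    using assms by (auto simp: dent_col_def)
  then show ?thesis using assms by auto
qed

lemma spp_mult_double: "e \<le> 1 \<Longrightarrow> spp_mult N (2 * m + e) = min (m + e) (N - m)"
  by (cases e) (auto simp: spp_mult_def)

text \<open>This identity produces the shape of the answer. Each \<open>spp_mult N\<close> is the
  exponent pattern of the product formula for symmetric plane partitions with N rows; the product
  for j - 1 and the shifted one for a appear in the numerator, the shifted one for j - k - 1 in the
  denominator, hence on the left side here.\<close>

lemma root_mult_spp:
  assumes "1 \<le> j" "k \<le> j" "j \<le> a + k + 1"
  shows "root_mult (a + k) j k s + spp_mult (j - k - 1) (s - 2 * k) =
    spp_mult a (s - 2 * k) + spp_mult (j - 1) s"
proof -
  define m e where "m = s div 2" and "e = s mod 2"
  have s: "s = 2 * m + e" "s div 2 = m" "e \<le> 1" by (auto simp: m_def e_def)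
  have R: "root_mult (a + k) j k s = a + k - m -
      (if s < j then a + k - s else if s < j + k then a + k + 1 - j else a + k + k - s)"
    unfolding root_mult_def s(2) using card_dent_col[of j "a + k" s k] assms by simp
  show ?thesis
  proof (cases "m < k")
    case True
    then have z: "spp_mult N (s - 2 * k) = 0" for N
      using s by (simp add: spp_mult_def)
    have sj: "spp_mult (j - 1) s = min (m + e) (j - 1 - m)"
      using spp_mult_double[OF s(3)] s(1) by metis
    show ?thesis
    proof (cases "s < j")
      case s_j: True
      have "a + k - m - (a + k - s) = m + e" "m + e \<le> j - 1 - m" using s s_j assms by auto
      then show ?thesis unfolding z R sj using s_j by simp
    next
      case s_j: False
      have "s < j + k" using s True assms by simp
      moreover have "a + k - m - (a + k + 1 - j) = j - 1 - m" "j - 1 - m \<le> m + e"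
        using s s_j assms by auto
      ultimately show ?thesis unfolding z R sj using s_j by simp
    qed
  next
    case False
    define t J where "t = m - k" and "J = j - k"
    have t: "m = k + t" "j = k + J" "J \<le> a + 1" using False assms by (auto simp: t_def J_def)
    have s': "s - 2 * k = 2 * t + e" using s t by simp
    have R: "root_mult (a + k) j k s = a - t - (if k + 2 * t + e < J then a - k - 2 * t - e
        else if 2 * t + e < J then a + 1 - J else a - 2 * t - e)"
      unfolding R unfolding s(1) t by auto
    have goal: "?thesis \<longleftrightarrow> root_mult (a + k) j k s + min (t + e) (J - 1 - t) =
        min (t + e) (a - t) + min (k + t + e) (J - 1 - t)"
      unfolding s' spp_mult_double[OF s(3)] unfolding s(1) spp_mult_double[OF s(3)] t by simp
    \<comment> \<open>The number s lies before, inside or after the removed block j, ..., j + k -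
      1.\<close>
    consider "k + 2 * t + e < J" | "J \<le> k + 2 * t + e" "2 * t + e < J" | "J \<le> 2 * t + e"
      by linarith
    then show ?thesis
    proof cases
      case 1
      then have "root_mult (a + k) j k s = k + t + e" "t + e \<le> J - 1 - t" "t + e \<le> a - t"
        "k + t + e \<le> J - 1 - t"
        unfolding R using t(3) by auto
      then show ?thesis unfolding goal by simp
    next
      case 2
      then have "root_mult (a + k) j k s = J - 1 - t" "t + e \<le> J - 1 - t" "t + e \<le> a - t"
        "J - 1 - t \<le> k + t + e"
        unfolding R using t(3) by auto
      then show ?thesis unfolding goal by simp
    next
      case 3
      then have "root_mult (a + k) j k s = a - t - (a - 2 * t - e)" "J - 1 - t \<le> t + e"
        unfolding R using t(3) s(3) by auto
      moreover have "a - t - (a - 2 * t - e) = min (t + e) (a - t)" by (simp add: min_def)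
      ultimately show ?thesis unfolding goal by simp
    qed
  qed
qed

lemma sum_dent_col:
  assumes "1 \<le> j" "j \<le> r + 1"
  shows "2 * (\<Sum>l<r. dent_col j k l) = r * (r + 1) + 2 * k * (r + 1 - j)"
proof -
  have "(\<Sum>l<r. dent_col j k l) = (\<Sum>l<r. (l + 1) + (if l \<in> {j - 1..<r} then k else 0))"
    using assms by (intro sum.cong) (auto simp: dent_col_def)
  also have "\<dots> = (\<Sum>l<r. l + 1) + (\<Sum>l<r. if l \<in> {j - 1..<r} then k else 0)"
    by (rule sum.distrib)
  also have "(\<Sum>l<r. if l \<in> {j - 1..<r} then k else 0) = (\<Sum>l\<in>{j - 1..<r}. k)"
    by (intro sum.mono_neutral_cong_right) auto
  also have "\<dots> = (r + 1 - j) * k" using assms by simp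
  finally have "2 * (\<Sum>l<r. dent_col j k l) = 2 * (\<Sum>l<r. l + 1) + 2 * ((r + 1 - j) * k)" by simp
  moreover have "2 * (\<Sum>l<r. l + 1) = r * (r + 1)" by (induction r) auto
  ultimately show ?thesis by simp
qed

text \<open>With r = a + k, both sides are r (r + 1) / 2 - k (r + 1 - j): the roots already found
  exhaust the degree bound.\<close>

lemma sum_root_mult:
  assumes "1 \<le> j" "k \<le> j" "j \<le> a + k + 1"
  shows "(\<Sum>i<a + k. 2 * i + 2) - (\<Sum>l<a + k. dent_col j k l) = (\<Sum>s=1..2 * (a + k). root_mult (a + k) j k s)"
proof -
  let ?r = "a + k"
  define M where "M = (\<Sum>s=1..2 * ?r. root_mult ?r j k s)"
  have "M + (\<Sum>s=1..2 * ?r. spp_mult (j - k - 1) (s - 2 * k)) =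
      (\<Sum>s=1..2 * ?r. spp_mult a (s - 2 * k)) + (\<Sum>s=1..2 * ?r. spp_mult (j - 1) s)"
    unfolding M_def sum.distrib[symmetric] using assms by (intro sum.cong root_mult_spp) auto
  moreover have "2 * (\<Sum>s=1..2 * ?r. spp_mult (j - k - 1) (s - 2 * k)) = (j - k - 1) * (j - k)"
  proof -
    have "(j - k - 1) * (j - k - 1 + 1) = (j - k - 1) * (j - k)" by (cases "j - k") auto
    then show ?thesis using sum_spp_mult[of "j - k - 1" "2 * a"] assms unfolding spp_mult_shift(2) by simp
  qed
  moreover have "2 * (\<Sum>s=1..2 * ?r. spp_mult a (s - 2 * k)) = a * (a + 1)"
    using sum_spp_mult[of a "2 * a"] unfolding spp_mult_shift(2) by simp
  moreover have "2 * (\<Sum>s=1..2 * ?r. spp_mult (j - 1) s) = (j - 1) * j"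
    using sum_spp_mult[of "j - 1" "2 * ?r"] assms by simp
  ultimately have M2: "2 * M + (j - k - 1) * (j - k) = a * (a + 1) + (j - 1) * j" by linarith
  \<comment> \<open>Expressing a and j by J, b and k turns the identity into a polynomial one over
    the integers, free of truncated subtraction.\<close>
  define J b where "J = j - k" and "b = a + 1 - J"
  have J: "j = J + k" "a + 1 = J + b" using assms by (auto simp: J_def b_def)
  have "2 * M + 2 * (\<Sum>l<?r. dent_col j k l) = 2 * (?r * (?r + 1))"
  proof -
    have "2 * (\<Sum>l<?r. dent_col j k l) = ?r * (?r + 1) + 2 * k * b"
      using sum_dent_col[of j ?r k] assms J by simp
    moreover have "2 * M + 2 * k * b = ?r * (?r + 1)"
    proof -
      have "int ((j - k - 1) * (j - k)) = (int J - 1) * int J" by (cases J) (auto simp: J algebra_simps)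
      moreover have "int ((j - 1) * j) = (int j - 1) * int j" using assms by (simp add: of_nat_diff)
      ultimately have "2 * int M + (int J - 1) * int J = int a * (int a + 1) + (int j - 1) * int j"
      proof -
        assume e: "int ((j - k - 1) * (j - k)) = (int J - 1) * int J" "int ((j - 1) * j) = (int j - 1) * int j"
        have "int (2 * M) + int ((j - k - 1) * (j - k)) = int (a * (a + 1)) + int ((j - 1) * j)"
          using M2 by (metis of_nat_add)
        then show ?thesis unfolding e by (simp add: algebra_simps)
      qed
      moreover have aj: "int a = int J + int b - 1" "int j = int J + int k" using J by auto
      ultimately have "2 * int M + 2 * int k * int b = (int a + int k) * (int a + int k + 1)"
        unfolding aj by (simp add: algebra_simps)
      then have "int (2 * M + 2 * k * b) = int (?r * (?r + 1))"
        by (simp add: algebra_simps)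
      then show ?thesis by (simp only: of_nat_eq_iff)
    qed
    ultimately show ?thesis by simp
  qed
  moreover have "(\<Sum>i<n. 2 * i + 2) = n * (n + 1)" for n :: nat by (induction n) auto
  ultimately show ?thesis by (simp add: M_def)
qed

section \<open>The determinant in factored form\<close>

lemma dent_col_ge_1: "1 \<le> dent_col j k l"
  by (simp add: dent_col_def)

text \<open>Every factor of the evaluation at 0 is positive. This excludes the zero polynomial, to
  which the comparison of degrees could not be applied.\<close>

lemma poly_det_poly_0_pos:
  assumes "1 \<le> j" "k \<le> j" "j \<le> a + k + 1"
  shows "poly (det_poly (a + k) (dent_col j k)) 0 > 0"
proof -
  define b where "b = a + k + 1 - j"
  have r: "a + k = j - 1 + b" using assms by (simp add: b_def)
  have "poly (det_poly (a + k) (dent_col j k)) 0 =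
      det (mat (a + k) (a + k) (\<lambda>(i, l). bump_entry i (dent_col j k l) 0))"
    by (rule poly_det_poly) (rule dent_col_ge_1)
  also have "\<dots> > 0"
    unfolding r det_bump_entry_0[OF assms(1,2)]
    using assms(1) by (intro mult_pos_pos prod_pos divide_pos_pos ballI) simp_all
  finally show ?thesis .
qed

lemma poly_det_poly_eq_prod:
  assumes "1 \<le> j" "k \<le> j" "j \<le> a + k + 1"
  shows "poly (det_poly (a + k) (dent_col j k)) x = poly (det_poly (a + k) (dent_col j k)) 0 *
    (\<Prod>s=1..2 * (a + k). ((2 * x + real s) / real s) ^ root_mult (a + k) j k s)"
proof -
  let ?r = "a + k"
  let ?D = "det_poly ?r (dent_col j k)"
  let ?Q = "\<Prod>s=1..2 * ?r. [:real s / 2, 1:] ^ root_mult ?r j k s"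
  have "?Q dvd ?D"
    unfolding root_mult_def
    by (intro prod_linear_powers_dvd linear_power_dvd_det_poly dent_col_ge_1) (auto simp: inj_on_def)
  then obtain R where R: "?D = ?Q * R" by (elim dvdE)
  have "?D \<noteq> 0" using poly_det_poly_0_pos[OF assms] by auto
  have "degree ?Q = (\<Sum>s=1..2 * ?r. degree ([:real s / 2, 1:] ^ root_mult ?r j k s))"
    by (rule degree_prod_eq_sum_degree) auto
  also have "\<dots> = (\<Sum>s=1..2 * ?r. root_mult ?r j k s)"
    by (simp only: degree_linear_power)
  finally have "degree ?D \<le> degree ?Q"
    using degree_det_poly[of ?r "dent_col j k"] sum_root_mult[OF assms] by simp
  moreover have "degree f = degree g + degree h" if "f = g * h" "f \<noteq> 0" for f g h :: "real poly"
    using that by (auto simp: degree_mult_eq)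
  from this[OF R \<open>?D \<noteq> 0\<close>] have "degree ?D = degree ?Q + degree R" .
  ultimately have "degree R = 0" by simp
  then obtain c where c: "R = [:c:]" by (metis degree_eq_zeroE)
  have D: "poly ?D y = (\<Prod>s=1..2 * ?r. (real s / 2 + y) ^ root_mult ?r j k s) * c" for y
    unfolding R c by (simp add: poly_prod poly_power)
  have "(\<Prod>s=1..2 * ?r. (real s / 2 + x) ^ root_mult ?r j k s) =
      (\<Prod>s=1..2 * ?r. (real s / 2 + 0) ^ root_mult ?r j k s) *
      (\<Prod>s=1..2 * ?r. ((2 * x + real s) / real s) ^ root_mult ?r j k s)"
    unfolding prod.distrib[symmetric] power_mult_distrib[symmetric]
    by (intro prod.cong refl arg_cong2[of _ _ _ _ power]) (auto simp: field_simps)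
  then show ?thesis unfolding D by simp
qed

section \<open>Translation into the products of the statement\<close>

lemma prod_int_atLeastAtMost: "(\<Prod>n=int u..int v. F n) = (\<Prod>n=u..v. F (int n))"
  by (simp add: image_int_atLeastAtMost[symmetric] prod.reindex)

lemma prod_split_parity:
  fixes h :: "nat \<Rightarrow> 'a :: comm_monoid_mult"
  shows "(\<Prod>s=1..2 * N. h s) = (\<Prod>l=1..N. h (2 * l - 1)) * (\<Prod>l=1..N. h (2 * l))"
  by (induction N) (auto simp: mult_ac)

text \<open>The tent f_N(l) is min(l, N + 1 - l). Odd s = 2 l - 1 thus carry the exponents f_N(l)
  and even s = 2 l the exponents f_(N - 1)(l), which is why the statement pairs its products this
  way.\<close>

lemma f_exponent_spp_mult:
  assumes "1 \<le> l" "l \<le> N"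
  shows "f_exponent (int N) (int l) = real (spp_mult N (2 * l - 1))"
    and "l < N \<Longrightarrow> f_exponent (int N - 1) (int l) = real (spp_mult N (2 * l))"
proof -
  obtain l' where l: "l = Suc l'" using assms by (cases l) auto
  have "spp_mult N (2 * l - 1) = min l (N + 1 - l)"
    using assms by (simp add: spp_mult_def l)
  moreover have "real (N + 1 - l) = real N + 1 - real l" using assms by (simp add: of_nat_diff)
  ultimately show "f_exponent (int N) (int l) = real (spp_mult N (2 * l - 1))"
    by (auto simp: f_exponent_def min_def abs_if field_simps)
  assume "l < N"
  have "spp_mult N (2 * l) = min l (N - l)"
    by (simp add: spp_mult_def)
  moreover have "real (N - l) = real N - real l" using assms by (simp add: of_nat_diff)
  ultimately show "f_exponent (int N - 1) (int l) = real (spp_mult N (2 * l))"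
    by (auto simp: f_exponent_def min_def abs_if field_simps)
qed

lemma prod_powr_f_exponent:
  assumes "\<And>y. y > 0 \<Longrightarrow> G y > 0"
  shows "(\<Prod>n=1..int N. G (2 * n - 1) powr f_exponent (int N) n)
    * (\<Prod>n=1..int N - 1. G (2 * n) powr f_exponent (int N - 1) n)
    = (\<Prod>s=1..2 * N. G (int s) ^ spp_mult N s)"
proof -
  have "(\<Prod>n=1..int N. G (2 * n - 1) powr f_exponent (int N) n)
      = (\<Prod>l=1..N. G (int (2 * l - 1)) ^ spp_mult N (2 * l - 1))"
  proof -
    have "(\<Prod>n=int 1..int N. G (2 * n - 1) powr f_exponent (int N) n)
        = (\<Prod>l=1..N. G (2 * int l - 1) powr f_exponent (int N) (int l))"
      by (rule prod_int_atLeastAtMost)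
    also have "\<dots> = (\<Prod>l=1..N. G (int (2 * l - 1)) ^ spp_mult N (2 * l - 1))"
    proof (intro prod.cong refl)
      fix l assume l: "l \<in> {1..N}"
      then have e: "2 * int l - 1 = int (2 * l - 1)" and "int (2 * l - 1) > 0" by auto
      moreover have "f_exponent (int N) (int l) = real (spp_mult N (2 * l - 1))"
        using l by (intro f_exponent_spp_mult(1)) auto
      ultimately show "G (2 * int l - 1) powr f_exponent (int N) (int l) = G (int (2 * l - 1)) ^ spp_mult N (2 * l - 1)"
        by (simp only: e) (rule powr_realpow[OF assms])
    qed
    finally show ?thesis by simp
  qed
  moreover have "(\<Prod>n=1..int N - 1. G (2 * n) powr f_exponent (int N - 1) n)
      = (\<Prod>l=1..N. G (int (2 * l)) ^ spp_mult N (2 * l))"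
  proof (cases N)
    case (Suc M)
    have "(\<Prod>n=int 1..int M. G (2 * n) powr f_exponent (int N - 1) n)
        = (\<Prod>l=1..M. G (2 * int l) powr f_exponent (int N - 1) (int l))"
      by (rule prod_int_atLeastAtMost)
    also have "\<dots> = (\<Prod>l=1..M. G (int (2 * l)) ^ spp_mult N (2 * l))"
    proof (intro prod.cong refl)
      fix l assume l: "l \<in> {1..M}"
      then have e: "2 * int l = int (2 * l)" and "int (2 * l) > 0" by auto
      moreover have "f_exponent (int N - 1) (int l) = real (spp_mult N (2 * l))"
        using l Suc by (intro f_exponent_spp_mult(2)) auto
      ultimately show "G (2 * int l) powr f_exponent (int N - 1) (int l) = G (int (2 * l)) ^ spp_mult N (2 * l)"
        by (simp only: e) (rule powr_realpow[OF assms])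
    qed
    \<comment> \<open>The added factor l = N has exponent \<open>spp_mult N (2 * N)\<close> =
      0.\<close>
    also have "\<dots> = (\<Prod>l=1..N. G (int (2 * l)) ^ spp_mult N (2 * l))"
      by (simp add: Suc spp_mult_def)
    finally show ?thesis using Suc by simp
  qed simp
  ultimately show ?thesis
    by (simp only: prod_split_parity[of "\<lambda>s. G (int s) ^ spp_mult N s"])
qed

lemma prod_int_pairs:
  "(\<Prod>(n, m)\<in>{(n, m). 1 \<le> n \<and> n \<le> m \<and> m \<le> int N}. F n m) =
    (\<Prod>(n, m)\<in>{(n, m). 1 \<le> n \<and> n \<le> m \<and> m \<le> N}. F (int n) (int m))"
proof -
  have "{(n, m). 1 \<le> n \<and> n \<le> m \<and> m \<le> int N} =
      map_prod int int ` {(n, m). 1 \<le> n \<and> n \<le> m \<and> m \<le> N}" (is "?A = ?f ` ?B")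
  proof (intro equalityI subsetI)
    fix z assume "z \<in> ?A"
    then obtain n m where "z = (n, m)" "1 \<le> n" "n \<le> m" "m \<le> int N" by auto
    then have "z = ?f (nat n, nat m)" "(nat n, nat m) \<in> ?B" by auto
    then show "z \<in> ?f ` ?B" by blast
  qed auto
  moreover have "inj_on (map_prod int int) ?B" by (auto simp: inj_on_def)
  ultimately show ?thesis by (simp add: prod.reindex case_prod_beta)
qed

lemma prod_quotient_fact:
  "(\<Prod>m=u+1..u+d. real (c + m) / real (e + m)) =
    fact (c + u + d) / fact (c + u) * (fact (e + u) / fact (e + u + d))"
proof (induction d)
  case (Suc d)
  have "(\<Prod>m=u+1..u+Suc d. real (c + m) / real (e + m)) =
      (\<Prod>m=u+1..u+d. real (c + m) / real (e + m)) * (real (Suc (c + u + d)) / real (Suc (e + u + d)))"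
    by (simp add: ac_simps)
  also have "\<dots> = fact (c + u + Suc d) / fact (c + u) * (fact (e + u) / fact (e + u + Suc d))"
    unfolding Suc by (simp add: field_simps del: of_nat_Suc)
  finally show ?case .
qed simp

text \<open>Both inner products are quotients of factorials, with p = n - 1. Between them (j - k +
  p)! cancels, and the outer denominator j + p removes the top factor of (j + p)!.\<close>

lemma const_factor:
  assumes "1 \<le> j" "k \<le> j"
  shows "real (k + j + p) / real (j + p) *
      ((\<Prod>m=1..j - k. real (k + p + m) / real (p + m)) *
       (\<Prod>m=j - k + 1..j - k + p. real (2 * k + p + m) / real (p + m))) =
    fact (j + p - 1) * real (j + k + p) * fact p * fact (j + k + 2 * p)
      / (fact (k + p) * fact (j - k + 2 * p) * fact (j + k + p))"
proof -
  have 1: "(\<Prod>m=1..j - k. real (k + p + m) / real (p + m)) =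
      fact (j + p) / fact (k + p) * (fact p / fact (j - k + p))"
    using prod_quotient_fact[of "k + p" p 0 "j - k"] assms by (simp add: ac_simps)
  have e: "2 * k + p + (j - k) = j + k + p" "p + (j - k) = j - k + p"
    "j + k + p + p = j + k + 2 * p" "j - k + p + p = j - k + 2 * p"
    using assms by auto
  have 2: "(\<Prod>m=j - k + 1..j - k + p. real (2 * k + p + m) / real (p + m)) =
      fact (j + k + 2 * p) / fact (j + k + p) * (fact (j - k + p) / fact (j - k + 2 * p))"
    using prod_quotient_fact[of "2 * k + p" p "j - k" p] unfolding e .
  have 3: "fact (j + p) = real (j + p) * (fact (j + p - 1) :: real)"
    using assms by (intro fact_reduce) simp
  show ?thesis unfolding 1 2 3 using assms by (simp add: field_simps del: of_nat_add)
qed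

theorem theorem2p2:
  fixes a k x :: nat and j :: int
  assumes "max 1 (int k) \<le> j" and "j \<le> int a + int k + 1"
  shows "M_region a k j x =
      (\<Prod>n=1..int a. (real_of_int (2 * int x + 2 * int k + 2 * n - 1)
                       / real_of_int (2 * int k + 2 * n - 1)) powr f_exponent (int a) n)
    * (\<Prod>n=1..int a - 1. (real_of_int (int x + int k + n)
                       / real_of_int (int k + n)) powr f_exponent (int a - 1) n)
    * (\<Prod>n=1..j - int k - 1. (real_of_int (2 * int k + 2 * n - 1)
                       / real_of_int (2 * int x + 2 * int k + 2 * n - 1)) powr f_exponent (j - int k - 1) n)
    * (\<Prod>n=1..j - int k - 2. (real_of_int (int k + n)
                       / real_of_int (int x + int k + n)) powr f_exponent (j - int k - 2) n)
    * (\<Prod>(n, m)\<in>{(n, m). 1 \<le> n \<and> n \<le> m \<and> m \<le> j - 1}.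
         real_of_int (2 * int x + n + m - 1) / real_of_int (n + m - 1))
    * (\<Prod>n=1..int a - j + int k + 1.
         real_of_int (int k + j + n - 1) / real_of_int (j + n - 1))
    * (1 / 2 ^ (a + k))
    * (\<Prod>n=1..int a - j + int k + 1.
         (\<Prod>m=1..j - int k. real_of_int (int k + n + m - 1) / real_of_int (n + m - 1))
       * (\<Prod>m=j - int k + 1..j - int k - 1 + n.
            real_of_int (2 * int k + n + m - 1) / real_of_int (n + m - 1)))"
proof -
  define J where "J = nat j"
  have j: "j = int J" "1 \<le> J" "k \<le> J" "J \<le> a + k + 1" using assms by (auto simp: J_def)
  let ?r = "a + k"
  \<comment> \<open>The linear factor with root -s/2, normalized to the value 1 at x = 0.\<close>
  define \<rho> where "\<rho> s = (2 * real x + real s) / real s" for s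
  define b where "b = a + k + 1 - J"
  have b: "int a - j + int k + 1 = int b" "?r = J - 1 + b" using j by (auto simp: b_def)
  have \<rho>_pos: "\<rho> s > 0" if "s > 0" for s using that by (simp add: \<rho>_def add_nonneg_pos)
  \<comment> \<open>Doubling both sides of the fraction writes the integral factors as \<rho> or its
    inverse at an even index.\<close>
  have halve: "real_of_int (int x + int k + n) / real_of_int (int k + n) =
      real_of_int (2 * int x + 2 * int k + 2 * n) / real_of_int (2 * int k + 2 * n)"
    "real_of_int (int k + n) / real_of_int (int x + int k + n) =
      real_of_int (2 * int k + 2 * n) / real_of_int (2 * int x + 2 * int k + 2 * n)" for n
    using mult_divide_mult_cancel_left[of 2 "real_of_int (int x + int k + n)" "real_of_int (int k + n)"]
      mult_divide_mult_cancel_left[of 2 "real_of_int (int k + n)" "real_of_int (int x + int k + n)"]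
    by (simp_all add: distrib_left)
  have A: "(\<Prod>n=1..int a. (real_of_int (2 * int x + 2 * int k + 2 * n - 1)
                       / real_of_int (2 * int k + 2 * n - 1)) powr f_exponent (int a) n)
    * (\<Prod>n=1..int a - 1. (real_of_int (int x + int k + n)
                       / real_of_int (int k + n)) powr f_exponent (int a - 1) n)
    = (\<Prod>s=1..2 * ?r. \<rho> s ^ spp_mult a (s - 2 * k))"
  proof -
    define G where "G y = real_of_int (2 * int x + 2 * int k + y) / real_of_int (2 * int k + y)" for y
    have "G (int s) = \<rho> (s + 2 * k)" for s by (simp add: G_def \<rho>_def algebra_simps)
    then show ?thesis
      using prod_powr_f_exponent[of G a]
      unfolding spp_mult_shift halve by (simp add: G_def add_diff_eq)
  qed
  have B: "(\<Prod>n=1..j - int k - 1. (real_of_int (2 * int k + 2 * n - 1)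
                       / real_of_int (2 * int x + 2 * int k + 2 * n - 1)) powr f_exponent (j - int k - 1) n)
    * (\<Prod>n=1..j - int k - 2. (real_of_int (int k + n)
                       / real_of_int (int x + int k + n)) powr f_exponent (j - int k - 2) n)
    = inverse (\<Prod>s=1..2 * ?r. \<rho> s ^ spp_mult (J - k - 1) (s - 2 * k))"
  proof (cases "J = k")
    \<comment> \<open>For j = k the upper limits are -1 and -2, so the products are empty; on the
      other side truncated subtraction gives \<open>spp_mult 0\<close>, which is 0
      everywhere.\<close>
    case True
    then show ?thesis using j by (simp add: spp_mult_def)
  next
    case False
    define N where "N = J - k - 1"
    have N: "j - int k - 1 = int N" "j - int k - 2 = int N - 1" "N \<le> a" using False j by (auto simp: N_def)
    define G where "G y = real_of_int (2 * int k + y) / real_of_int (2 * int x + 2 * int k + y)" for y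
    have G: "G (int s) = inverse (\<rho> (s + 2 * k))" for s by (simp add: G_def \<rho>_def algebra_simps)
    have "(\<Prod>s=1..2 * ?r. \<rho> s ^ spp_mult N (s - 2 * k)) = (\<Prod>s=1..2 * N. \<rho> (s + 2 * k) ^ spp_mult N s)"
      unfolding spp_mult_shift using N(3)
      by (intro prod.mono_neutral_right) (auto simp: spp_mult_def)
    moreover have "inverse (\<Prod>s=1..2 * N. \<rho> (s + 2 * k) ^ spp_mult N s) = (\<Prod>s=1..2 * N. G (int s) ^ spp_mult N s)"
      by (simp add: G prod_inversef power_inverse flip: prod_inversef)
    moreover have "(\<Prod>n=1..int N. G (2 * n - 1) powr f_exponent (int N) n)
        * (\<Prod>n=1..int N - 1. G (2 * n) powr f_exponent (int N - 1) n)
        = (\<Prod>s=1..2 * N. G (int s) ^ spp_mult N s)"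
      by (rule prod_powr_f_exponent) (simp add: G_def)
    ultimately show ?thesis
      unfolding N halve N_def[symmetric] by (simp add: G_def add_diff_eq)
  qed
  have C: "(\<Prod>(n, m)\<in>{(n, m). 1 \<le> n \<and> n \<le> m \<and> m \<le> j - 1}.
         real_of_int (2 * int x + n + m - 1) / real_of_int (n + m - 1))
    = (\<Prod>s=1..2 * ?r. \<rho> s ^ spp_mult (J - 1) s)"
  proof -
    have "j - 1 = int (J - 1)" using j by simp
    moreover have "(\<Prod>(n, m)\<in>{(n, m). 1 \<le> n \<and> n \<le> m \<and> m \<le> J - 1}.
         real_of_int (2 * int x + int n + int m - 1) / real_of_int (int n + int m - 1))
      = (\<Prod>(n, m)\<in>{(n, m). 1 \<le> n \<and> n \<le> m \<and> m \<le> J - 1}. \<rho> (n + m - 1))"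
      by (intro prod.cong refl) (auto simp: \<rho>_def of_nat_diff algebra_simps)
    ultimately show ?thesis
      using j prod_spp_mult[of "J - 1" "2 * ?r" \<rho>] by (simp only: prod_int_pairs) simp
  qed
  have D: "poly (det_poly ?r (dent_col J k)) 0 =
      (\<Prod>n=1..int a - j + int k + 1. real_of_int (int k + j + n - 1) / real_of_int (j + n - 1))
    * (1 / 2 ^ (a + k))
    * (\<Prod>n=1..int a - j + int k + 1.
         (\<Prod>m=1..j - int k. real_of_int (int k + n + m - 1) / real_of_int (n + m - 1))
       * (\<Prod>m=j - int k + 1..j - int k - 1 + n.
            real_of_int (2 * int k + n + m - 1) / real_of_int (n + m - 1)))"
  proof -
    have shift: "(\<Prod>n=1..int b. F n) = (\<Prod>p<b. F (1 + int p))" for F :: "int \<Rightarrow> real"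
      using prod_int_atLeastAtMost[of F 1 b] prod.atLeast1_atMost_eq[of "\<lambda>n. F (int n)" b] by simp
    have jk: "j - int k = int (J - k)" using j by simp
    have in1: "(\<Prod>m=1..int (J - k). real_of_int (int k + (1 + int p) + m - 1) / real_of_int (1 + int p + m - 1))
        = (\<Prod>m=1..J - k. real (k + p + m) / real (p + m))" for p
      using prod_int_atLeastAtMost[of "\<lambda>m. real_of_int (int k + (1 + int p) + m - 1) / real_of_int (1 + int p + m - 1)" 1 "J - k"]
      by (simp add: ac_simps)
    have in2: "(\<Prod>m=int (J - k) + 1..int (J - k) - 1 + (1 + int p).
          real_of_int (2 * int k + (1 + int p) + m - 1) / real_of_int (1 + int p + m - 1))
        = (\<Prod>m=J - k + 1..J - k + p. real (2 * k + p + m) / real (p + m))" for p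
      using prod_int_atLeastAtMost[of "\<lambda>m. real_of_int (2 * int k + (1 + int p) + m - 1) / real_of_int (1 + int p + m - 1)" "J - k + 1" "J - k + p"]
      by (simp add: ac_simps)
    have out: "real_of_int (int k + j + (1 + int p) - 1) / real_of_int (j + (1 + int p) - 1)
        = real (k + J + p) / real (J + p)" for p
      by (simp add: j)
    have "poly (det_poly ?r (dent_col J k)) 0 =
        det (mat ?r ?r (\<lambda>(i, l). bump_entry i (dent_col J k l) 0))"
      by (rule poly_det_poly) (rule dent_col_ge_1)
    also have "\<dots> = 1 / 2 ^ ?r * (\<Prod>p<b. real (k + J + p) / real (J + p) *
      ((\<Prod>m=1..J - k. real (k + p + m) / real (p + m)) *
       (\<Prod>m=J - k + 1..J - k + p. real (2 * k + p + m) / real (p + m))))"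
      unfolding b(2) det_bump_entry_0[OF j(2,3)] const_factor[OF j(2,3)] ..
    finally show ?thesis
      unfolding b(1) shift jk in1 in2 out prod.distrib by (simp only: mult_ac)
  qed
  have "M_region a k j x = poly (det_poly ?r (dent_col J k)) (real x)"
    unfolding j(1) M_region_eq_det[OF j(2,4)]
    by (rule poly_det_poly[symmetric]) (rule dent_col_ge_1)
  also have "\<dots> = poly (det_poly ?r (dent_col J k)) 0 * (\<Prod>s=1..2 * ?r. \<rho> s ^ root_mult ?r J k s)"
    unfolding \<rho>_def by (rule poly_det_poly_eq_prod[OF j(2,3,4)])
  also have "(\<Prod>s=1..2 * ?r. \<rho> s ^ root_mult ?r J k s) =
      (\<Prod>s=1..2 * ?r. \<rho> s ^ spp_mult a (s - 2 * k)) * (\<Prod>s=1..2 * ?r. \<rho> s ^ spp_mult (J - 1) s)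
      * inverse (\<Prod>s=1..2 * ?r. \<rho> s ^ spp_mult (J - k - 1) (s - 2 * k))"
  proof -
    have "(\<Prod>s=1..2 * ?r. \<rho> s ^ root_mult ?r J k s) * (\<Prod>s=1..2 * ?r. \<rho> s ^ spp_mult (J - k - 1) (s - 2 * k))
        = (\<Prod>s=1..2 * ?r. \<rho> s ^ spp_mult a (s - 2 * k)) * (\<Prod>s=1..2 * ?r. \<rho> s ^ spp_mult (J - 1) s)"
      unfolding prod.distrib[symmetric] power_add[symmetric] root_mult_spp[OF j(2,3,4)] ..
    moreover have "(\<Prod>s=1..2 * ?r. \<rho> s ^ spp_mult (J - k - 1) (s - 2 * k)) \<noteq> 0"
      using \<rho>_pos by (auto simp: less_imp_neq[symmetric] dest: less_imp_neq)
    ultimately show ?thesis by (simp add: field_simps)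
  qed
  finally show ?thesis
    unfolding A[symmetric] B[symmetric] C[symmetric] D by (simp only: mult_ac)
qed

end
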